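(* Let $\omega\ge1$ be an integer, and let $c_1,c_3,\varepsilon_1,\varepsilon_2$ be the fixed constants (depending only on $\omega$, with $c_1$ universal) described in the context. Let $\gamma:\mathbb{S}^1\times[0,\infty)\to\mathbb{R}^2$ be a free elastic flow with absolute turning number $\omega$ and $\varepsilon(0)<\varepsilon_2$. Then for any integer $m\ge1$ and all $t\ge0$, $$\|k_{s^m}(\cdot,t)\|_\infty\le C(1+t)^{-(m+1+c_1)/4},$$ where $C$ depends only on $m$, $\omega$, $L(0)$, and the value of $\|k_{s^{2m+1}}\|_2^2$ at $t=0$.
   Context: $\mathbb{S}^1:=\mathbb{R}/\mathbb{Z}$. For a smooth immersion $\gamma:\mathbb{S}^1\to\mathbb{R}^2$: $\partial_s:=|\gamma_u|^{-1}\partial_u$, $ds:=|\gamma_u|\,du$, $\tau:=\gamma_s$, $\nu$ is the rotation of $\tau$ counterclockwise by $\pi/2$, $k:=\langle\gamma_{ss},\nu\rangle$ is the signed curvature, $k_{s^m}:=\partial_s^mk$, and $L[\gamma]=\int_{\mathbb{S}^1}ds$. Norms: $\|f\|_2^2=\int_{\mathbb{S}^1}f^2\,ds$ and $\|f\|_\infty=\sup_{\mathbb{S}^1}|f|$, at each fixed time. A free elastic flow is a smooth one-parameter family of smooth immersed curves $\gamma:\mathbb{S}^1\times[0,\infty)\to\mathbb{R}^2$ satisfying $\partial_t\gamma=-(k_{ss}+\frac12k^3)\nu$. Write $L(t):=L[\gamma(\cdot,t)]$ and $\varepsilon(t):=L(t)^3\int k_s^2\,ds$ (integral along $\gamma(\cdot,t)$).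 The absolute turning number is $\omega:=\left|\frac1{2\pi}\int k\,ds\right|$, a non-negative integer independent of $t$. Define $\hat C(\sigma,\omega):=4+12\omega^2+\sqrt{\tfrac{8\omega^2}{\pi^3}}\sqrt\sigma+\tfrac{1}{4\pi^3}\sigma$. Constants: $c_1>0$ is a universal constant, and for the given $\omega\ge1$, $0<\varepsilon_2<\varepsilon_1$ and $c_3>0$ are constants depending only on $\omega$, fixed such that: (i) $\varepsilon_1\hat C(\varepsilon_1,\omega)\le16\omega^4\pi^4$; (ii) every free elastic flow on $[0,\infty)$ with absolute turning number $\omega$ and $\varepsilon(0)\le\varepsilon_2$ satisfies, for all $t\ge0$, $\varepsilon(t)\le\varepsilon_1$ and $\varepsilon(t)\le c_3\left(1+\frac{t}{L(0)^4}\right)^{-c_1}$. (Such constants exist.) As these constants are fixed in terms of $\omega$, dependence of $C$ on them counts as dependence on $\omega$. *)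

theory Defs
  imports "HOL-Analysis.Analysis"
begin

text \<open>
  The plane is \<^typ>\<open>complex\<close> with its Euclidean norm and inner product, so that multiplication
  by \<^term>\<open>\<i>\<close> is the counterclockwise rotation by a right angle.  Functions on the circle
  R/Z are 1-periodic functions of a real parameter \<open>u\<close>.
\<close>

section \<open>Geometry of a single curve\<close>

definition speed :: "(real \<Rightarrow> complex) \<Rightarrow> real \<Rightarrow> real" where
  "speed c u = norm (vector_derivative c (at u))"

definition arc_deriv :: "(real \<Rightarrow> complex) \<Rightarrow> (real \<Rightarrow> 'a::real_normed_vector) \<Rightarrow> real \<Rightarrow> 'a" where
  "arc_deriv c f u = vector_derivative f (at u) /\<^sub>R speed c u"

definition arc_integral :: "(real \<Rightarrow> complex) \<Rightarrow> (real \<Rightarrow> real) \<Rightarrow> real" where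
  "arc_integral c f = integral {0..1} (\<lambda>u. f u * speed c u)"

definition tangent :: "(real \<Rightarrow> complex) \<Rightarrow> real \<Rightarrow> complex" where
  "tangent c = arc_deriv c c"

definition normal :: "(real \<Rightarrow> complex) \<Rightarrow> real \<Rightarrow> complex" where
  "normal c u = \<i> * tangent c u"

definition curvature :: "(real \<Rightarrow> complex) \<Rightarrow> real \<Rightarrow> real" where
  "curvature c u = inner (arc_deriv c (arc_deriv c c) u) (normal c u)"

definition curvature_deriv :: "(real \<Rightarrow> complex) \<Rightarrow> nat \<Rightarrow> real \<Rightarrow> real" where
  "curvature_deriv c m = (arc_deriv c ^^ m) (curvature c)"

definition curve_length :: "(real \<Rightarrow> complex) \<Rightarrow> real" where
  "curve_length c = arc_integral c (\<lambda>u. 1)"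

definition L2_norm_sq :: "(real \<Rightarrow> complex) \<Rightarrow> (real \<Rightarrow> real) \<Rightarrow> real" where
  "L2_norm_sq c f = arc_integral c (\<lambda>u. (f u)\<^sup>2)"

definition sup_norm :: "(real \<Rightarrow> real) \<Rightarrow> real" where
  "sup_norm f = (SUP u. \<bar>f u\<bar>)"

definition abs_turning_number :: "(real \<Rightarrow> complex) \<Rightarrow> real" where
  "abs_turning_number c = \<bar>1 / (2 * pi) * arc_integral c (curvature c)\<bar>"

definition scaled_energy :: "(real \<Rightarrow> complex) \<Rightarrow> real" where
  "scaled_energy c = curve_length c ^ 3 * L2_norm_sq c (curvature_deriv c 1)"

definition C_hat :: "real \<Rightarrow> nat \<Rightarrow> real" where
  "C_hat \<sigma> \<omega> = 4 + 12 * (real \<omega>)\<^sup>2 + sqrt (8 * (real \<omega>)\<^sup>2 / pi ^ 3) * sqrt \<sigma> + 1 / (4 * pi ^ 3) * \<sigma>"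

section \<open>Free elastic flows\<close>

text \<open>
  A family of curves is written \<open>\<gamma> t u\<close>, so that \<open>\<gamma> t\<close> is the curve at time \<open>t\<close>.
  Only times \<open>t \<ge> 0\<close> matter.  Smoothness is joint in \<open>(t, u)\<close> up to and including \<open>t = 0\<close>, where
  time derivatives are one-sided: all iterated partial derivatives, in any order, exist and are
  jointly continuous.
\<close>

primrec C_k_family :: "nat \<Rightarrow> (real \<Rightarrow> real \<Rightarrow> 'a::real_normed_vector) \<Rightarrow> bool" where
  "C_k_family 0 f \<longleftrightarrow> continuous_on ({0..} \<times> UNIV) (\<lambda>(t, u). f t u)"
| "C_k_family (Suc n) f \<longleftrightarrow>
     continuous_on ({0..} \<times> UNIV) (\<lambda>(t, u). f t u) \<and>
     (\<exists>f_t f_u.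
        (\<forall>t\<ge>0. \<forall>u.
           ((\<lambda>s. f s u) has_vector_derivative f_t t u) (at t within {0..}) \<and>
           ((\<lambda>v. f t v) has_vector_derivative f_u t u) (at u)) \<and>
        C_k_family n f_t \<and> C_k_family n f_u)"

definition smooth_family :: "(real \<Rightarrow> real \<Rightarrow> 'a::real_normed_vector) \<Rightarrow> bool" where
  "smooth_family f \<longleftrightarrow> (\<forall>n. C_k_family n f)"

definition free_elastic_flow :: "(real \<Rightarrow> real \<Rightarrow> complex) \<Rightarrow> bool" where
  "free_elastic_flow \<gamma> \<longleftrightarrow>
     smooth_family \<gamma> \<and>
     (\<forall>t\<ge>0. \<forall>u. \<gamma> t (u + 1) = \<gamma> t u) \<and>
     (\<forall>t\<ge>0. \<forall>u. vector_derivative (\<gamma> t) (at u) \<noteq> 0) \<and>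
     (\<forall>t\<ge>0. \<forall>u.
        ((\<lambda>s. \<gamma> s u) has_vector_derivative
           - (curvature_deriv (\<gamma> t) 2 u + 1/2 * curvature (\<gamma> t) u ^ 3) *\<^sub>R normal (\<gamma> t) u)
          (at t within {0..}))"

text \<open>
  The absolute turning number is constant along a flow; it is read off from the initial curve, so
  that its invariance is not part of the hypotheses.
\<close>

definition flow_turning_number :: "(real \<Rightarrow> real \<Rightarrow> complex) \<Rightarrow> real" where
  "flow_turning_number \<gamma> = abs_turning_number (\<gamma> 0)"

end

theory Submission
  imports Defs
begin

text \<open>
  The curve of length \<open>L\<close> is rescaled to unit length: \<open>b i = L\<^sup>i\<^sup>+\<^sup>1 k\<^sub>i\<close> for the \<open>i\<close>-th arc length
  derivative \<open>k\<^sub>i\<close> of the curvature, and \<open>n i\<close> is the \<open>L\<^sup>2\<close> norm of \<open>b i\<close>.  Then \<open>n 1\<close> squared is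
  the scaled energy, and \<open>Q i\<close>, the square of \<open>n i\<close>, is the scale-invariant energy
  \<open>L\<^sup>2\<^sup>i\<^sup>+\<^sup>1 \<integral> k\<^sub>i\<^sup>2 ds\<close>.  Every derivative has mean zero, so that \<open>\<bar>b m\<bar> \<le> n (m + 1)\<close>, and \<open>m\<close> integrations
  by parts together with Cauchy-Schwarz give \<open>n (m + 1)\<^sup>2 \<le> n 1 * n (2m + 1)\<close>.  Hence
  \<open>L\<^sup>m\<^sup>+\<^sup>1 \<bar>k\<^sub>m\<bar>\<close> is at most the fourth root of the scaled energy times \<open>Q (2m + 1)\<close>
  (\<open>curvature_deriv_sup_bound\<close>).  The asserted decay is the product of three facts: the scaled energy
  decays like \<open>(1 + t)\<close> to the power \<open>-c1\<close> by hypothesis, \<open>L\<^sup>4\<close> grows at least linearly, and \<open>Q (2m + 1)\<close>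
  stays bounded.

  Growth of the length (\<open>L_growth\<close>): \<open>L' = \<integral> k F ds\<close> with \<open>F = k\<^sub>2 + k\<^sup>3/2\<close>, which becomes
  \<open>L\<^sup>3 L' = \<integral> (b 0)\<^sup>4 / 2 - \<integral> (b 1)\<^sup>2\<close> after an integration by parts.  The total curvature is conserved, so
  Jensen's inequality bounds the first term below by half the fourth power of \<open>2 \<pi> \<omega>\<close>, and the condition
  on \<open>\<epsilon>1\<close> makes the second term small in comparison.

  Boundedness of \<open>Q l\<close> (\<open>scaled_energy_bound\<close>): along the flow \<open>\<partial>\<^sub>t k\<^sub>l = - k\<^sub>l\<^sub>+\<^sub>4 + f + g\<close>, where \<open>f\<close> is cubic
  in the \<open>k\<^sub>i\<close> with \<open>l + 2\<close> derivatives in each monomial and \<open>g\<close> is quintic with \<open>l\<close> derivatives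
  (\<open>curvature_deriv_evolution\<close>).  In the rescaled variables
  \<open>L\<^sup>4 (Q l)'\<close> consists of \<open>- 2 n (l + 2)\<^sup>2\<close> and of terms which interpolation between \<open>n 1\<close> and \<open>n (l + 2)\<close> bounds by a
  smaller power of \<open>n (l + 2)\<close> (\<open>unit_jet_energy_inequality\<close>).  This yields \<open>L\<^sup>4 (Q l)' \<le> C - Q l\<close>, and
  therefore \<open>Q l\<close> never exceeds the maximum of \<open>C\<close> and its initial value.
\<close>

section \<open>Differential polynomials on jet space\<close>

text \<open>
  A point of jet space is the sequence of the curvature and its arc length derivatives at one point of a
  curve.  The first index counts the factors of each monomial, the second its derivatives.  All estimates
  are governed by these two numbers, so the coefficients that the evolution equations produce can stay
  implicit.
\<close>

inductive jet_poly :: "nat \<Rightarrow> nat \<Rightarrow> ((nat \<Rightarrow> real) \<Rightarrow> real) \<Rightarrow> bool" where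
  coord: "jet_poly 1 i (\<lambda>a. a i)"
| add: "jet_poly p w f \<Longrightarrow> jet_poly p w g \<Longrightarrow> jet_poly p w (\<lambda>a. f a + g a)"
| scale: "jet_poly p w f \<Longrightarrow> jet_poly p w (\<lambda>a. c * f a)"
| mult: "jet_poly p w f \<Longrightarrow> jet_poly q v g \<Longrightarrow> jet_poly (p + q) (w + v) (\<lambda>a. f a * g a)"

lemma jet_poly_degree_pos: "jet_poly p w f \<Longrightarrow> p \<ge> 1"
  by (induction rule: jet_poly.induct) auto

text \<open>
  Under dilation of a curve by \<open>1 / c\<close> the \<open>i\<close>-th derivative of the curvature is multiplied by the
  power \<open>i + 1\<close> of \<open>c\<close>; this is what makes the rescaling to unit length consistent.
\<close>

lemma jet_poly_homogeneous:
  assumes "jet_poly p w f"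
  shows "f (\<lambda>i. c ^ Suc i * a i) = c ^ (p + w) * f a"
  using assms by (induction rule: jet_poly.induct) (simp_all add: power_add algebra_simps)

definition total_derivative :: "((nat \<Rightarrow> real) \<Rightarrow> real) \<Rightarrow> ((nat \<Rightarrow> real) \<Rightarrow> real) \<Rightarrow> bool" where
  "total_derivative f g \<longleftrightarrow>
     (\<forall>a \<sigma> u. (\<forall>i. (a i has_real_derivative \<sigma> * a (Suc i) u) (at u)) \<longrightarrow>
           ((\<lambda>u. f (\<lambda>i. a i u)) has_real_derivative \<sigma> * g (\<lambda>i. a i u)) (at u))"

lemma jet_poly_total_derivative:
  assumes "jet_poly p w f"
  obtains g where "jet_poly p (Suc w) g"
    and "total_derivative f g"
proof -
  have "\<exists>g. jet_poly p (Suc w) g \<and> total_derivative f g"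
    using assms
  proof (induction rule: jet_poly.induct)
    case (coord i)
    show ?case
      by (intro exI[of _ "\<lambda>a. a (Suc i)"] conjI jet_poly.coord) (auto simp: total_derivative_def)
  next
    case (add p w f g)
    then obtain f' g' where "jet_poly p (Suc w) f'" "jet_poly p (Suc w) g'"
      and "total_derivative f f'"
      and "total_derivative g g'"
      by blast
    then show ?case
      by (intro exI[of _ "\<lambda>a. f' a + g' a"] conjI jet_poly.add)
        (auto simp: total_derivative_def algebra_simps intro!: derivative_eq_intros)
  next
    case (scale p w f c)
    then obtain f' where "jet_poly p (Suc w) f'"
      and "total_derivative f f'"
      by blast
    then show ?case
      by (intro exI[of _ "\<lambda>a. c * f' a"] conjI jet_poly.scale)
        (auto simp: total_derivative_def algebra_simps intro!: derivative_eq_intros)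
  next
    case (mult p w f q v g)
    then obtain f' g' where f': "jet_poly p (Suc w) f'" and g': "jet_poly q (Suc v) g'"
      and d: "total_derivative f f'"
        "total_derivative g g'"
      by blast
    have "jet_poly (p + q) (Suc (w + v)) (\<lambda>a. f' a * g a + f a * g' a)"
      using jet_poly.mult[OF f' mult(2)] jet_poly.mult[OF mult(1) g']
      by (intro jet_poly.add) auto
    with d show ?case
      by (intro exI[of _ "\<lambda>a. f' a * g a + f a * g' a"])
        (auto simp: total_derivative_def algebra_simps intro!: derivative_eq_intros)
  qed
  with that show thesis by blast
qed

lemma jet_poly_bound:
  assumes "jet_poly p w f"
  obtains C where "C \<ge> 0" and "\<And>a \<kappa> \<mu>. \<kappa> \<ge> 0 \<Longrightarrow> \<mu> \<ge> 0 \<Longrightarrow>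
           (\<And>i. i \<le> w \<Longrightarrow> \<bar>a i\<bar> \<le> \<kappa> * \<mu> ^ i) \<Longrightarrow> \<bar>f a\<bar> \<le> C * \<kappa> ^ p * \<mu> ^ w"
proof -
  have "\<exists>C\<ge>0. \<forall>a \<kappa> \<mu>. \<kappa> \<ge> 0 \<longrightarrow> \<mu> \<ge> 0 \<longrightarrow>
           (\<forall>i\<le>w. \<bar>a i\<bar> \<le> \<kappa> * \<mu> ^ i) \<longrightarrow> \<bar>f a\<bar> \<le> C * \<kappa> ^ p * \<mu> ^ w"
    using assms
  proof (induction rule: jet_poly.induct)
    case (coord i)
    show ?case by (rule exI[of _ 1]) auto
  next
    case (add p w f g)
    then obtain C D where "C \<ge> 0" "D \<ge> 0"
      and f: "\<And>a \<kappa> \<mu>. \<kappa> \<ge> 0 \<Longrightarrow> \<mu> \<ge> 0 \<Longrightarrow> (\<forall>i\<le>w. \<bar>a i\<bar> \<le> \<kappa> * \<mu> ^ i) \<Longrightarrow> \<bar>f a\<bar> \<le> C * \<kappa> ^ p * \<mu> ^ w"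
      and g: "\<And>a \<kappa> \<mu>. \<kappa> \<ge> 0 \<Longrightarrow> \<mu> \<ge> 0 \<Longrightarrow> (\<forall>i\<le>w. \<bar>a i\<bar> \<le> \<kappa> * \<mu> ^ i) \<Longrightarrow> \<bar>g a\<bar> \<le> D * \<kappa> ^ p * \<mu> ^ w"
      by blast
    have "\<bar>f a + g a\<bar> \<le> (C + D) * \<kappa> ^ p * \<mu> ^ w"
      if "\<kappa> \<ge> 0" "\<mu> \<ge> 0" "\<forall>i\<le>w. \<bar>a i\<bar> \<le> \<kappa> * \<mu> ^ i" for a \<kappa> \<mu>
      using f[OF that] g[OF that] by (simp add: algebra_simps)
    with \<open>C \<ge> 0\<close> \<open>D \<ge> 0\<close> show ?case by (intro exI[of _ "C + D"]) auto
  next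
    case (scale p w f c)
    then obtain C where "C \<ge> 0"
      and f: "\<And>a \<kappa> \<mu>. \<kappa> \<ge> 0 \<Longrightarrow> \<mu> \<ge> 0 \<Longrightarrow> (\<forall>i\<le>w. \<bar>a i\<bar> \<le> \<kappa> * \<mu> ^ i) \<Longrightarrow> \<bar>f a\<bar> \<le> C * \<kappa> ^ p * \<mu> ^ w"
      by blast
    have "\<bar>c * f a\<bar> \<le> (\<bar>c\<bar> * C) * \<kappa> ^ p * \<mu> ^ w"
      if "\<kappa> \<ge> 0" "\<mu> \<ge> 0" "\<forall>i\<le>w. \<bar>a i\<bar> \<le> \<kappa> * \<mu> ^ i" for a \<kappa> \<mu>
      using mult_left_mono[OF f[OF that], of "\<bar>c\<bar>"] by (simp add: abs_mult mult.assoc)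
    with \<open>C \<ge> 0\<close> show ?case by (intro exI[of _ "\<bar>c\<bar> * C"]) auto
  next
    case (mult p w f q v g)
    then obtain C D where C: "C \<ge> 0" "D \<ge> 0"
      and f: "\<And>a \<kappa> \<mu>. \<kappa> \<ge> 0 \<Longrightarrow> \<mu> \<ge> 0 \<Longrightarrow> (\<forall>i\<le>w. \<bar>a i\<bar> \<le> \<kappa> * \<mu> ^ i) \<Longrightarrow> \<bar>f a\<bar> \<le> C * \<kappa> ^ p * \<mu> ^ w"
      and g: "\<And>a \<kappa> \<mu>. \<kappa> \<ge> 0 \<Longrightarrow> \<mu> \<ge> 0 \<Longrightarrow> (\<forall>i\<le>v. \<bar>a i\<bar> \<le> \<kappa> * \<mu> ^ i) \<Longrightarrow> \<bar>g a\<bar> \<le> D * \<kappa> ^ q * \<mu> ^ v"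
      by blast
    have "\<bar>f a * g a\<bar> \<le> (C * D) * \<kappa> ^ (p + q) * \<mu> ^ (w + v)"
      if "\<kappa> \<ge> 0" "\<mu> \<ge> 0" "\<forall>i\<le>w + v. \<bar>a i\<bar> \<le> \<kappa> * \<mu> ^ i" for a \<kappa> \<mu>
    proof -
      have "\<bar>f a\<bar> \<le> C * \<kappa> ^ p * \<mu> ^ w" "\<bar>g a\<bar> \<le> D * \<kappa> ^ q * \<mu> ^ v"
        using f[of \<kappa> \<mu> a] g[of \<kappa> \<mu> a] that by auto
      then have "\<bar>f a\<bar> * \<bar>g a\<bar> \<le> (C * \<kappa> ^ p * \<mu> ^ w) * (D * \<kappa> ^ q * \<mu> ^ v)"
        using that C by (intro mult_mono) auto
      then show ?thesis by (simp add: abs_mult power_add mult_ac)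
    qed
    with C show ?case by (intro exI[of _ "C * D"]) auto
  qed
  with that show thesis by blast
qed

text \<open>
  A monomial with \<open>w\<close> derivatives in total contains the \<open>w\<close>-th derivative at most once, and all its other
  factors are then undifferentiated.  So a bound that is linear in \<open>a w\<close> holds even when \<open>a w\<close> itself is
  not controlled pointwise, as happens for the highest derivative that the energy estimate controls.
\<close>

lemma jet_poly_bound_top:
  assumes "jet_poly p w f" and "w \<ge> 1"
  obtains C where "C \<ge> 0" and "\<And>a \<kappa> \<mu>. \<kappa> \<ge> 0 \<Longrightarrow> \<mu> \<ge> 0 \<Longrightarrow>
           (\<And>i. i < w \<Longrightarrow> \<bar>a i\<bar> \<le> \<kappa> * \<mu> ^ i) \<Longrightarrow>
           \<bar>f a\<bar> \<le> C * \<kappa> ^ (p - 1) * (\<kappa> * \<mu> ^ w + \<bar>a w\<bar>)"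
proof -
  have "w \<ge> 1 \<longrightarrow> (\<exists>C\<ge>0. \<forall>a \<kappa> \<mu>. \<kappa> \<ge> 0 \<longrightarrow> \<mu> \<ge> 0 \<longrightarrow>
           (\<forall>i<w. \<bar>a i\<bar> \<le> \<kappa> * \<mu> ^ i) \<longrightarrow> \<bar>f a\<bar> \<le> C * \<kappa> ^ (p - 1) * (\<kappa> * \<mu> ^ w + \<bar>a w\<bar>))"
    using assms(1)
  proof (induction rule: jet_poly.induct)
    case (coord i)
    show ?case by (intro impI exI[of _ 1]) auto
  next
    case (add p w f g)
    show ?case
    proof
      assume "1 \<le> w"
      with add obtain C D where "C \<ge> 0" "D \<ge> 0"
        and f: "\<And>a \<kappa> \<mu>. \<kappa> \<ge> 0 \<Longrightarrow> \<mu> \<ge> 0 \<Longrightarrow> (\<forall>i<w. \<bar>a i\<bar> \<le> \<kappa> * \<mu> ^ i) \<Longrightarrow> \<bar>f a\<bar> \<le> C * \<kappa> ^ (p - 1) * (\<kappa> * \<mu> ^ w + \<bar>a w\<bar>)"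
        and g: "\<And>a \<kappa> \<mu>. \<kappa> \<ge> 0 \<Longrightarrow> \<mu> \<ge> 0 \<Longrightarrow> (\<forall>i<w. \<bar>a i\<bar> \<le> \<kappa> * \<mu> ^ i) \<Longrightarrow> \<bar>g a\<bar> \<le> D * \<kappa> ^ (p - 1) * (\<kappa> * \<mu> ^ w + \<bar>a w\<bar>)"
        by blast
      have "\<bar>f a + g a\<bar> \<le> (C + D) * \<kappa> ^ (p - 1) * (\<kappa> * \<mu> ^ w + \<bar>a w\<bar>)"
        if "\<kappa> \<ge> 0" "\<mu> \<ge> 0" "\<forall>i<w. \<bar>a i\<bar> \<le> \<kappa> * \<mu> ^ i" for a \<kappa> \<mu>
        using f[OF that] g[OF that] by (simp only: distrib_right) linarith
      with \<open>C \<ge> 0\<close> \<open>D \<ge> 0\<close> show "\<exists>C\<ge>0. \<forall>a \<kappa> \<mu>. \<kappa> \<ge> 0 \<longrightarrow> \<mu> \<ge> 0 \<longrightarrow>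
           (\<forall>i<w. \<bar>a i\<bar> \<le> \<kappa> * \<mu> ^ i) \<longrightarrow> \<bar>f a + g a\<bar> \<le> C * \<kappa> ^ (p - 1) * (\<kappa> * \<mu> ^ w + \<bar>a w\<bar>)"
        by (intro exI[of _ "C + D"]) auto
    qed
  next
    case (scale p w f c)
    show ?case
    proof
      assume "1 \<le> w"
      with scale obtain C where "C \<ge> 0"
        and f: "\<And>a \<kappa> \<mu>. \<kappa> \<ge> 0 \<Longrightarrow> \<mu> \<ge> 0 \<Longrightarrow> (\<forall>i<w. \<bar>a i\<bar> \<le> \<kappa> * \<mu> ^ i) \<Longrightarrow> \<bar>f a\<bar> \<le> C * \<kappa> ^ (p - 1) * (\<kappa> * \<mu> ^ w + \<bar>a w\<bar>)"
        by blast
      have "\<bar>c * f a\<bar> \<le> (\<bar>c\<bar> * C) * \<kappa> ^ (p - 1) * (\<kappa> * \<mu> ^ w + \<bar>a w\<bar>)"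
        if "\<kappa> \<ge> 0" "\<mu> \<ge> 0" "\<forall>i<w. \<bar>a i\<bar> \<le> \<kappa> * \<mu> ^ i" for a \<kappa> \<mu>
        using mult_left_mono[OF f[OF that], of "\<bar>c\<bar>"] by (simp add: abs_mult mult.assoc)
      with \<open>C \<ge> 0\<close> show "\<exists>C\<ge>0. \<forall>a \<kappa> \<mu>. \<kappa> \<ge> 0 \<longrightarrow> \<mu> \<ge> 0 \<longrightarrow>
           (\<forall>i<w. \<bar>a i\<bar> \<le> \<kappa> * \<mu> ^ i) \<longrightarrow> \<bar>c * f a\<bar> \<le> C * \<kappa> ^ (p - 1) * (\<kappa> * \<mu> ^ w + \<bar>a w\<bar>)"
        by (intro exI[of _ "\<bar>c\<bar> * C"]) auto
    qed
  next
    case (mult p w f q v g)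
    have pq: "p \<ge> 1" "q \<ge> 1" using mult jet_poly_degree_pos by auto
    obtain C where C: "C \<ge> 0" "\<And>a \<kappa> \<mu>. \<kappa> \<ge> 0 \<Longrightarrow> \<mu> \<ge> 0 \<Longrightarrow>
           (\<And>i. i \<le> w \<Longrightarrow> \<bar>a i\<bar> \<le> \<kappa> * \<mu> ^ i) \<Longrightarrow> \<bar>f a\<bar> \<le> C * \<kappa> ^ p * \<mu> ^ w"
      using jet_poly_bound[OF mult(1)] by blast
    obtain D where D: "D \<ge> 0" "\<And>a \<kappa> \<mu>. \<kappa> \<ge> 0 \<Longrightarrow> \<mu> \<ge> 0 \<Longrightarrow>
           (\<And>i. i \<le> v \<Longrightarrow> \<bar>a i\<bar> \<le> \<kappa> * \<mu> ^ i) \<Longrightarrow> \<bar>g a\<bar> \<le> D * \<kappa> ^ q * \<mu> ^ v"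
      using jet_poly_bound[OF mult(2)] by blast
    show ?case
    proof
      assume "1 \<le> w + v"
      consider "v = 0" "w \<ge> 1" | "w = 0" "v \<ge> 1" | "w \<ge> 1" "v \<ge> 1"
        using \<open>1 \<le> w + v\<close> by linarith
      then show "\<exists>C\<ge>0. \<forall>a \<kappa> \<mu>. \<kappa> \<ge> 0 \<longrightarrow> \<mu> \<ge> 0 \<longrightarrow>
           (\<forall>i<w + v. \<bar>a i\<bar> \<le> \<kappa> * \<mu> ^ i) \<longrightarrow>
           \<bar>f a * g a\<bar> \<le> C * \<kappa> ^ (p + q - 1) * (\<kappa> * \<mu> ^ (w + v) + \<bar>a (w + v)\<bar>)"
      proof cases
        case 1
        then obtain C' where C': "C' \<ge> 0" "\<And>a \<kappa> \<mu>. \<kappa> \<ge> 0 \<Longrightarrow> \<mu> \<ge> 0 \<Longrightarrow>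
           (\<forall>i<w. \<bar>a i\<bar> \<le> \<kappa> * \<mu> ^ i) \<Longrightarrow> \<bar>f a\<bar> \<le> C' * \<kappa> ^ (p - 1) * (\<kappa> * \<mu> ^ w + \<bar>a w\<bar>)"
          using mult by blast
        have "\<bar>f a * g a\<bar> \<le> (C' * D) * \<kappa> ^ (p + q - 1) * (\<kappa> * \<mu> ^ (w + v) + \<bar>a (w + v)\<bar>)"
          if "\<kappa> \<ge> 0" "\<mu> \<ge> 0" "\<forall>i<w + v. \<bar>a i\<bar> \<le> \<kappa> * \<mu> ^ i" for a \<kappa> \<mu>
        proof -
          have "\<bar>f a\<bar> \<le> C' * \<kappa> ^ (p - 1) * (\<kappa> * \<mu> ^ w + \<bar>a w\<bar>)" "\<bar>g a\<bar> \<le> D * \<kappa> ^ q * \<mu> ^ v"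
            using C'(2)[of \<kappa> \<mu> a] D(2)[of \<kappa> \<mu> a] that 1 by auto
          then have "\<bar>f a\<bar> * \<bar>g a\<bar> \<le> (C' * \<kappa> ^ (p - 1) * (\<kappa> * \<mu> ^ w + \<bar>a w\<bar>)) * (D * \<kappa> ^ q * \<mu> ^ v)"
            using that C' by (intro mult_mono) auto
          moreover have "\<kappa> ^ (p + q - 1) = \<kappa> ^ (p - 1) * \<kappa> ^ q"
            using pq by (simp flip: power_add)
          ultimately show ?thesis using 1 by (simp add: abs_mult mult_ac)
        qed
        with C' D show ?thesis by (intro exI[of _ "C' * D"]) auto
      next
        case 2
        then obtain D' where D': "D' \<ge> 0" "\<And>a \<kappa> \<mu>. \<kappa> \<ge> 0 \<Longrightarrow> \<mu> \<ge> 0 \<Longrightarrow>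
           (\<forall>i<v. \<bar>a i\<bar> \<le> \<kappa> * \<mu> ^ i) \<Longrightarrow> \<bar>g a\<bar> \<le> D' * \<kappa> ^ (q - 1) * (\<kappa> * \<mu> ^ v + \<bar>a v\<bar>)"
          using mult by blast
        have "\<bar>f a * g a\<bar> \<le> (C * D') * \<kappa> ^ (p + q - 1) * (\<kappa> * \<mu> ^ (w + v) + \<bar>a (w + v)\<bar>)"
          if "\<kappa> \<ge> 0" "\<mu> \<ge> 0" "\<forall>i<w + v. \<bar>a i\<bar> \<le> \<kappa> * \<mu> ^ i" for a \<kappa> \<mu>
        proof -
          have "\<bar>g a\<bar> \<le> D' * \<kappa> ^ (q - 1) * (\<kappa> * \<mu> ^ v + \<bar>a v\<bar>)" "\<bar>f a\<bar> \<le> C * \<kappa> ^ p * \<mu> ^ w"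
            using D'(2)[of \<kappa> \<mu> a] C(2)[of \<kappa> \<mu> a] that 2 by auto
          then have "\<bar>f a\<bar> * \<bar>g a\<bar> \<le> (C * \<kappa> ^ p * \<mu> ^ w) * (D' * \<kappa> ^ (q - 1) * (\<kappa> * \<mu> ^ v + \<bar>a v\<bar>))"
            using that C by (intro mult_mono) auto
          moreover have "\<kappa> ^ (p + q - 1) = \<kappa> ^ p * \<kappa> ^ (q - 1)"
            using pq by (simp flip: power_add)
          ultimately show ?thesis using 2 by (simp add: abs_mult mult_ac)
        qed
        with D' C show ?thesis by (intro exI[of _ "C * D'"]) auto
      next
        case 3
        have "\<bar>f a * g a\<bar> \<le> (C * D) * \<kappa> ^ (p + q - 1) * (\<kappa> * \<mu> ^ (w + v) + \<bar>a (w + v)\<bar>)"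
          if "\<kappa> \<ge> 0" "\<mu> \<ge> 0" "\<forall>i<w + v. \<bar>a i\<bar> \<le> \<kappa> * \<mu> ^ i" for a \<kappa> \<mu>
        proof -
          have "\<bar>f a\<bar> \<le> C * \<kappa> ^ p * \<mu> ^ w" "\<bar>g a\<bar> \<le> D * \<kappa> ^ q * \<mu> ^ v"
            using C(2)[of \<kappa> \<mu> a] D(2)[of \<kappa> \<mu> a] that 3 by auto
          then have "\<bar>f a\<bar> * \<bar>g a\<bar> \<le> (C * \<kappa> ^ p * \<mu> ^ w) * (D * \<kappa> ^ q * \<mu> ^ v)"
            using that C by (intro mult_mono) auto
          also have "\<dots> = (C * D) * \<kappa> ^ (p + q - 1) * (\<kappa> * \<mu> ^ (w + v))"
          proof -
            have "\<kappa> ^ p * \<kappa> ^ q = \<kappa> ^ (p + q - 1) * \<kappa>"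
              using pq by (simp flip: power_add power_Suc2)
            then show ?thesis by (simp add: power_add mult_ac)
          qed
          also have "\<dots> \<le> (C * D) * \<kappa> ^ (p + q - 1) * (\<kappa> * \<mu> ^ (w + v) + \<bar>a (w + v)\<bar>)"
            using that C D by (intro mult_left_mono) auto
          finally show ?thesis by (simp add: abs_mult)
        qed
        with C D show ?thesis by (intro exI[of _ "C * D"]) auto
      qed
    qed
  qed
  with assms(2) that show thesis by blast
qed


section \<open>Interpolation on a closed curve of unit length\<close>

text \<open>
  The discrete maximum principle: divided by \<open>A * \<mu> ^ i\<close> the sequence stays log-convex, so it takes its
  maximum at an end point, where it is at most 1.
\<close>

lemma log_convex_sequence_bound:
  fixes x :: "nat \<Rightarrow> real"
  assumes nonneg: "\<And>i. 0 \<le> x i"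
    and convex: "\<And>i. (x (Suc i))\<^sup>2 \<le> x i * x (Suc (Suc i))"
    and "A > 0" "\<mu> > 0" and start: "x 0 \<le> A" and final: "x N \<le> A * \<mu> ^ N" and "i \<le> N"
  shows "x i \<le> A * \<mu> ^ i"
proof (rule ccontr)
  assume contra: "\<not> x i \<le> A * \<mu> ^ i"
  define y where "y j = x j / (A * \<mu> ^ j)" for j
  define M where "M = Max (y ` {..N})"
  define j where "j = (LEAST j. j \<le> N \<and> y j = M)"
  have y_le: "y j \<le> M" if "j \<le> N" for j
    unfolding M_def using that by simp
  have "y i > 1"
    using contra \<open>A > 0\<close> \<open>\<mu> > 0\<close> by (simp add: y_def field_simps)
  then have "M > 1" using y_le[OF \<open>i \<le> N\<close>] by simp
  have "M \<in> y ` {..N}" unfolding M_def by (intro Max_in) auto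
  then have ex: "\<exists>j. j \<le> N \<and> y j = M" by auto
  have j: "j \<le> N" "y j = M" using LeastI_ex[OF ex] by (auto simp: j_def)
  have "y 0 \<le> 1" "y N \<le> 1"
    using start final \<open>A > 0\<close> \<open>\<mu> > 0\<close> by (auto simp: y_def field_simps)
  then have "j \<noteq> 0" "j \<noteq> N" using j \<open>M > 1\<close> by (metis not_le)+
  then obtain k where k: "j = Suc k" "Suc j \<le> N" using j by (cases j) auto
  have "y k \<noteq> M"
    using not_less_Least[of k "\<lambda>j. j \<le> N \<and> y j = M"] k by (auto simp: j_def)
  then have less: "y k < M" using y_le[of k] k by simp
  have y_nonneg: "0 \<le> y j" for j using nonneg \<open>A > 0\<close> \<open>\<mu> > 0\<close> by (simp add: y_def)
  have "(y (Suc k))\<^sup>2 \<le> y k * y (Suc (Suc k))"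
    using convex[of k] \<open>A > 0\<close> \<open>\<mu> > 0\<close>
    by (simp add: y_def field_simps power2_eq_square)
  also have "\<dots> \<le> y k * M" using y_le[of "Suc (Suc k)"] k y_nonneg by (intro mult_left_mono) auto
  also have "\<dots> < M * M" using less \<open>M > 1\<close> by simp
  finally show False using j k by (simp add: power2_eq_square)
qed

text \<open>
  The jets of the curvature along a closed curve of length 1 with speed \<open>\<sigma>\<close>, stripped of the curve:
  the interpolation inequalities use nothing but the chain rule and periodicity.
\<close>

locale unit_jet =
  fixes b :: "nat \<Rightarrow> real \<Rightarrow> real" and \<sigma> :: "real \<Rightarrow> real"
  assumes deriv: "(b i has_real_derivative \<sigma> u * b (Suc i) u) (at u)"
    and speed_continuous: "continuous_on UNIV \<sigma>"
    and speed_pos: "0 < \<sigma> u"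
    and periodic: "b i 1 = b i 0"
    and unit_length: "integral {0..1} \<sigma> = 1"
begin

text \<open>
  Since the total length is 1, this integral over arc length is also the mean value.
\<close>

definition J :: "(real \<Rightarrow> real) \<Rightarrow> real" where
  "J f = integral {0..1} (\<lambda>u. f u * \<sigma> u)"

definition n :: "nat \<Rightarrow> real" where
  "n i = sqrt (J (\<lambda>u. (b i u)\<^sup>2))"

lemma continuous_on_b [continuous_intros]: "continuous_on S (b i)"
  by (meson DERIV_isCont continuous_at_imp_continuous_on deriv)

lemma continuous_on_speed [continuous_intros]: "continuous_on S \<sigma>"
  using speed_continuous continuous_on_subset by blast

lemma J_integrable:
  assumes "continuous_on {0..1} f"
  shows "(\<lambda>u. f u * \<sigma> u) integrable_on {0..1}"
  by (intro integrable_continuous_real continuous_intros assms)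

lemma J_add:
  assumes "continuous_on {0..1} f" "continuous_on {0..1} g"
  shows "J (\<lambda>u. f u + g u) = J f + J g"
  using integral_add[OF assms[THEN J_integrable]] by (simp add: J_def distrib_right)

lemma J_cmult: "J (\<lambda>u. c * f u) = c * J f"
  by (simp add: J_def mult.assoc)

lemma J_const: "J (\<lambda>u. c) = c"
  using unit_length by (simp add: J_def)

lemma J_mono:
  assumes "continuous_on {0..1} f" "continuous_on {0..1} g" "\<And>u. u \<in> {0..1} \<Longrightarrow> f u \<le> g u"
  shows "J f \<le> J g"
  unfolding J_def using speed_pos
  by (intro integral_le J_integrable assms mult_right_mono) (auto intro: less_imp_le)

lemma J_nonneg:
  assumes "continuous_on {0..1} f" "\<And>u. u \<in> {0..1} \<Longrightarrow> 0 \<le> f u"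
  shows "0 \<le> J f"
  using J_mono[of "\<lambda>_. 0" f] assms J_const[of 0] by simp

lemma J_Cauchy_Schwarz:
  assumes f: "continuous_on {0..1} f" and g: "continuous_on {0..1} g"
  shows "(J (\<lambda>u. f u * g u))\<^sup>2 \<le> J (\<lambda>u. (f u)\<^sup>2) * J (\<lambda>u. (g u)\<^sup>2)"
proof -
  define p q r where "p = J (\<lambda>u. f u * g u)" and "q = J (\<lambda>u. (f u)\<^sup>2)" and "r = J (\<lambda>u. (g u)\<^sup>2)"
  have quadratic: "0 \<le> x\<^sup>2 * q - 2 * x * y * p + y\<^sup>2 * r" for x y
  proof -
    have "0 \<le> J (\<lambda>u. (x * f u - y * g u)\<^sup>2)"
      by (intro J_nonneg continuous_intros f g) auto
    also have "(\<lambda>u. (x * f u - y * g u)\<^sup>2) =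
        (\<lambda>u. (x\<^sup>2 * (f u)\<^sup>2 + (- (2 * x * y)) * (f u * g u)) + y\<^sup>2 * (g u)\<^sup>2)"
      by (auto simp: fun_eq_iff power2_eq_square algebra_simps)
    also have "J \<dots> = x\<^sup>2 * q - 2 * x * y * p + y\<^sup>2 * r"
      unfolding p_def q_def r_def
      by (subst J_add J_cmult; (intro continuous_intros f g)?)+ simp
    finally show ?thesis .
  qed
  have "q \<ge> 0" "r \<ge> 0" unfolding q_def r_def by (intro J_nonneg continuous_intros f g; simp)+
  have "p\<^sup>2 \<le> q * r"
  proof (cases "r = 0")
    case True
    \<comment> \<open>any second argument above \<open>q / 2\<close> gives a negative value unless \<open>p = 0\<close>\<close>
    with quadratic[of p "q + 1"] have "0 \<le> - (p\<^sup>2 * (q + 2))"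
      by (simp add: power2_eq_square algebra_simps)
    then have "p\<^sup>2 * (q + 2) \<le> 0" by simp
    with \<open>q \<ge> 0\<close> have "p\<^sup>2 \<le> 0" by (simp add: mult_le_0_iff)
    with True show ?thesis by simp
  next
    case False
    with \<open>r \<ge> 0\<close> have "r > 0" by simp
    have "0 \<le> r * (q * r - p\<^sup>2)"
      using quadratic[of r p] by (simp add: power2_eq_square algebra_simps)
    with \<open>r > 0\<close> show ?thesis by (simp add: zero_le_mult_iff)
  qed
  then show ?thesis by (simp add: p_def q_def r_def)
qed

lemma n_nonneg: "0 \<le> n i"
  unfolding n_def by (intro real_sqrt_ge_zero J_nonneg continuous_intros) auto

lemma n_squared: "(n i)\<^sup>2 = J (\<lambda>u. (b i u)\<^sup>2)"
  unfolding n_def by (intro real_sqrt_pow2 J_nonneg continuous_intros) auto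

lemma J_product_le: "\<bar>J (\<lambda>u. b i u * b j u)\<bar> \<le> n i * n j"
proof (rule power2_le_imp_le)
  show "\<bar>J (\<lambda>u. b i u * b j u)\<bar>\<^sup>2 \<le> (n i * n j)\<^sup>2"
    using J_Cauchy_Schwarz[of "b i" "b j"] by (simp add: continuous_intros power_mult_distrib n_squared)
qed (simp add: n_nonneg)

lemma mean_derivative_zero: "J (b (Suc i)) = 0"
proof -
  have "((\<lambda>u. \<sigma> u * b (Suc i) u) has_integral (b i 1 - b i 0)) {0..1}"
    by (intro fundamental_theorem_of_calculus)
      (auto intro!: has_field_derivative_at_within deriv simp flip: has_real_derivative_iff_has_vector_derivative)
  then show ?thesis
    by (simp add: J_def periodic integral_unique mult.commute)
qed

lemma integration_by_parts: "J (\<lambda>u. b (Suc i) u * b j u) = - J (\<lambda>u. b i u * b (Suc j) u)"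
proof -
  have d: "((\<lambda>u. b i u * b j u) has_real_derivative (b (Suc i) u * b j u + b i u * b (Suc j) u) * \<sigma> u) (at u)" for u
    using deriv[of i u] deriv[of j u] by (auto intro!: derivative_eq_intros simp: algebra_simps)
  have "((\<lambda>u. (b (Suc i) u * b j u + b i u * b (Suc j) u) * \<sigma> u) has_integral (b i 1 * b j 1 - b i 0 * b j 0)) {0..1}"
    by (intro fundamental_theorem_of_calculus)
      (auto intro!: has_field_derivative_at_within d simp flip: has_real_derivative_iff_has_vector_derivative)
  then have "J (\<lambda>u. b (Suc i) u * b j u + b i u * b (Suc j) u) = 0"
    by (simp add: J_def periodic integral_unique)
  then show ?thesis by (subst (asm) J_add) (auto intro!: continuous_intros)
qed

text \<open>
  The difference is the integral of the next derivative over an arc of length at most 1, so its \<open>L\<^sup>1\<close> norm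
  is dominated by the \<open>L\<^sup>2\<close> norm.
\<close>

lemma oscillation_le:
  assumes "u \<in> {0..1}" "v \<in> {0..1}"
  shows "\<bar>b i u - b i v\<bar> \<le> n (Suc i)"
proof -
  have *: "\<bar>b i u - b i v\<bar> \<le> J (\<lambda>u. \<bar>b (Suc i) u\<bar>)" if "0 \<le> v" "v \<le> u" "u \<le> 1" for u v
  proof -
    have "((\<lambda>u. \<sigma> u * b (Suc i) u) has_integral (b i u - b i v)) {v..u}"
      using that
      by (intro fundamental_theorem_of_calculus)
        (auto intro!: has_field_derivative_at_within deriv simp flip: has_real_derivative_iff_has_vector_derivative)
    then have "\<bar>b i u - b i v\<bar> = norm (integral {v..u} (\<lambda>u. \<sigma> u * b (Suc i) u))"
      by (simp add: integral_unique)
    also have "\<dots> \<le> integral {v..u} (\<lambda>u. \<bar>b (Suc i) u\<bar> * \<sigma> u)"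
      using speed_pos
      by (intro integral_norm_bound_integral integrable_continuous_real continuous_intros)
        (simp add: abs_mult less_imp_le)
    also have "\<dots> \<le> J (\<lambda>u. \<bar>b (Suc i) u\<bar>)"
      unfolding J_def using that speed_pos
      by (intro integral_subset_le integrable_continuous_real continuous_intros)
        (auto simp: less_imp_le)
    finally show ?thesis .
  qed
  have "\<bar>b i u - b i v\<bar> \<le> J (\<lambda>u. \<bar>b (Suc i) u\<bar>)"
    using *[of u v] *[of v u] assms by (cases "v \<le> u") (auto simp: abs_minus_commute)
  also have "\<dots> \<le> n (Suc i)"
  proof (rule power2_le_imp_le)
    show "(J (\<lambda>u. \<bar>b (Suc i) u\<bar>))\<^sup>2 \<le> (n (Suc i))\<^sup>2"
      using J_Cauchy_Schwarz[of "\<lambda>u. \<bar>b (Suc i) u\<bar>" "\<lambda>_. 1"]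
      by (simp add: continuous_intros n_squared J_const)
  qed (simp add: n_nonneg)
  finally show ?thesis .
qed

text \<open>
  Averaging the oscillation bound over the second point replaces a value by the mean.  This treats the
  curvature, whose mean is \<open>\<plusminus> 2 \<pi> \<omega>\<close> along the flow, in the same way as its derivatives, whose mean is 0.
\<close>

lemma sup_le:
  assumes "u \<in> {0..1}"
  shows "\<bar>b i u\<bar> \<le> \<bar>J (b i)\<bar> + n (Suc i)"
proof -
  have "J (b i) \<le> J (\<lambda>_. b i u + n (Suc i))"
    using oscillation_le[OF assms, of _ i] by (intro J_mono continuous_intros) (fastforce simp: abs_le_iff)
  moreover have "J (\<lambda>_. b i u - n (Suc i)) \<le> J (b i)"
    using oscillation_le[OF assms, of _ i] by (intro J_mono continuous_intros) (fastforce simp: abs_le_iff)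
  ultimately show ?thesis by (simp add: J_const)
qed

lemma sup_derivative_le:
  assumes "u \<in> {0..1}"
  shows "\<bar>b (Suc i) u\<bar> \<le> n (Suc (Suc i))"
  using sup_le[OF assms, of "Suc i"] by (simp add: mean_derivative_zero)

lemma n_log_convex: "(n (Suc i))\<^sup>2 \<le> n i * n (Suc (Suc i))"
proof -
  have "(n (Suc i))\<^sup>2 = J (\<lambda>u. b (Suc i) u * b (Suc i) u)"
    unfolding n_squared by (simp only: power2_eq_square)
  also have "\<dots> \<le> n i * n (Suc (Suc i))"
    using J_product_le[of i "Suc (Suc i)"] unfolding integration_by_parts by linarith
  finally show ?thesis .
qed

text \<open>
  Each integration by parts moves one derivative from the first factor to the second; after \<open>m\<close> of
  them \<open>b (m + 1)\<close> against itself has become \<open>b 1\<close> against \<open>b (2 m + 1)\<close>.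
\<close>

lemma n_middle_le: "(n (Suc m))\<^sup>2 \<le> n 1 * n (2 * m + 1)"
proof -
  have "\<bar>J (\<lambda>u. b (Suc m) u * b (Suc m) u)\<bar> = \<bar>J (\<lambda>u. b (Suc (m - j)) u * b (Suc (m + j)) u)\<bar>"
    if "j \<le> m" for j
    using that
  proof (induction j)
    case (Suc j)
    then have "m - j = Suc (m - Suc j)" by simp
    then have "\<bar>J (\<lambda>u. b (Suc (m - j)) u * b (Suc (m + j)) u)\<bar>
        = \<bar>J (\<lambda>u. b (Suc (m - Suc j)) u * b (Suc (m + Suc j)) u)\<bar>"
      using integration_by_parts[of "Suc (m - Suc j)" "Suc (m + j)"] by simp
    with Suc show ?case by simp
  qed simp
  from this[of m] have "(n (Suc m))\<^sup>2 \<le> \<bar>J (\<lambda>u. b 1 u * b (2 * m + 1) u)\<bar>"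
    unfolding n_squared by (simp add: power2_eq_square mult_2)
  also have "\<dots> \<le> n 1 * n (2 * m + 1)" by (rule J_product_le)
  finally show ?thesis .
qed

lemma sup_le_interpolated:
  assumes "u \<in> {0..1}" "m \<ge> 1"
  shows "\<bar>b m u\<bar> ^ 4 \<le> J (\<lambda>u. (b 1 u)\<^sup>2) * J (\<lambda>u. (b (2 * m + 1) u)\<^sup>2)"
proof -
  obtain m' where m: "m = Suc m'" using assms by (cases m) auto
  have "\<bar>b m u\<bar> ^ 4 \<le> (n (Suc m)) ^ 4"
    using sup_derivative_le[OF assms(1), of m'] by (intro power_mono) (auto simp: m)
  also have "\<dots> = ((n (Suc m))\<^sup>2)\<^sup>2" by simp
  also have "\<dots> \<le> (n 1 * n (2 * m + 1))\<^sup>2"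
    by (intro power_mono n_middle_le) auto
  finally show ?thesis by (simp add: power_mult_distrib n_squared)
qed

lemma continuous_on_jet_poly:
  assumes "jet_poly p w f"
  shows "continuous_on S (\<lambda>u. f (\<lambda>i. b i u))"
proof -
  obtain g where "((\<lambda>u. f (\<lambda>i. b i u)) has_real_derivative \<sigma> u * g (\<lambda>i. b i u)) (at u)" for u
    using jet_poly_total_derivative[OF assms] deriv unfolding total_derivative_def by metis
  then show ?thesis by (meson DERIV_isCont continuous_at_imp_continuous_on)
qed

text \<open>
  The number \<open>\<mu>\<close> is an inverse length scale read off from the highest norm.  Log-convexity makes the
  intermediate norms grow at most geometrically with ratio \<open>\<mu>\<close>, which turns interpolation inequalities
  with fractional exponents into comparisons of integral powers of \<open>\<mu>\<close>.  Taking \<open>\<mu> \<ge> 1\<close> lets lower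
  powers be absorbed by higher ones; the price is the additive \<open>A\<^sup>2\<close> in the last conclusion, which accounts
  for the case that the highest norm is below \<open>A\<close>.
\<close>

lemma interpolation_scale:
  assumes "A > 0" and "n 1 \<le> A"
  obtains \<mu> where "\<mu> \<ge> 1"
    and "\<And>i. 1 \<le> i \<Longrightarrow> i \<le> l + 2 \<Longrightarrow> n i \<le> A * \<mu> ^ (i - 1)"
    and "A\<^sup>2 * \<mu> ^ (2 * l + 2) \<le> A\<^sup>2 + (n (l + 2))\<^sup>2"
proof -
  define r where "r = max 1 (n (l + 2) / A)"
  define \<mu> where "\<mu> = root (l + 1) r"
  have "r \<ge> 1" by (simp add: r_def)
  then have \<mu>: "\<mu> \<ge> 1" by (simp add: \<mu>_def)
  have pow: "\<mu> ^ (l + 1) = r"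
    unfolding \<mu>_def using \<open>r \<ge> 1\<close> by (intro real_root_pow_pos2) auto
  have "n (l + 2) \<le> A * \<mu> ^ (l + 1)"
    unfolding pow using \<open>A > 0\<close> by (simp add: r_def max_def field_simps)
  then have n_Suc: "n (Suc j) \<le> A * \<mu> ^ j" if "j \<le> l + 1" for j
    using log_convex_sequence_bound[of "\<lambda>j. n (Suc j)" A \<mu> "l + 1" j] that assms \<mu>
    by (simp add: n_nonneg n_log_convex)
  have b: "n i \<le> A * \<mu> ^ (i - 1)" if "1 \<le> i" "i \<le> l + 2" for i
    using n_Suc[of "i - 1"] that by simp
  have "A\<^sup>2 * \<mu> ^ (2 * l + 2) = (A * r)\<^sup>2"
    unfolding pow[symmetric] power_mult_distrib power_mult[symmetric] by (simp add: mult.commute)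
  also have "\<dots> \<le> A\<^sup>2 + (n (l + 2))\<^sup>2"
    using \<open>A > 0\<close> by (auto simp: r_def max_def)
  finally show thesis using that \<mu> b by blast
qed

end

text \<open>
  With the scale \<open>\<mu>\<close> of the preceding lemma the good term \<open>- 2 n (l + 2)\<^sup>2\<close> is of order \<open>\<mu>\<close> to the power
  \<open>2 l + 2\<close>.  Pointwise \<open>\<bar>b i\<bar> \<le> B \<mu>\<^sup>i\<close> for \<open>i \<le> l + 1\<close>, so \<open>f + g\<close> is of order \<open>\<mu>\<^sup>l\<^sup>+\<^sup>2\<close> in \<open>L\<^sup>2\<close>, whereas \<open>b l\<close> is only
  of order \<open>\<mu>\<^sup>l\<^sup>-\<^sup>1\<close>: the \<open>L\<^sup>2\<close> interpolation gains one power of \<open>\<mu>\<close> over the pointwise one.  The nonlinear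
  terms are therefore of order \<open>\<mu>\<close> to the power \<open>2 l + 1\<close> and can be absorbed up to a constant.
\<close>

lemma unit_jet_energy_inequality:
  assumes f: "jet_poly 3 (l + 2) f" and g: "jet_poly 5 l g" and "l \<ge> 1"
    and "A > 0" "W \<ge> 0" "c \<ge> 0"
  obtains C where "\<And>b \<sigma>. unit_jet b \<sigma> \<Longrightarrow> \<bar>unit_jet.J \<sigma> (b 0)\<bar> \<le> W \<Longrightarrow>
      unit_jet.J \<sigma> (\<lambda>u. (b 1 u)\<^sup>2) \<le> A\<^sup>2 \<Longrightarrow>
      c * unit_jet.J \<sigma> (\<lambda>u. (b l u)\<^sup>2) - 2 * unit_jet.J \<sigma> (\<lambda>u. b l u * b (l + 4) u)
        + unit_jet.J \<sigma> (\<lambda>u. b l u * (f (\<lambda>i. b i u) + g (\<lambda>i. b i u)))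
      \<le> C - unit_jet.J \<sigma> (\<lambda>u. (b l u)\<^sup>2)"
proof -
  obtain C1 where C1: "C1 \<ge> 0" "\<And>a \<kappa> \<mu>. \<kappa> \<ge> 0 \<Longrightarrow> \<mu> \<ge> 0 \<Longrightarrow>
      (\<And>i. i < l + 2 \<Longrightarrow> \<bar>a i\<bar> \<le> \<kappa> * \<mu> ^ i) \<Longrightarrow>
      \<bar>f a\<bar> \<le> C1 * \<kappa> ^ (3 - 1) * (\<kappa> * \<mu> ^ (l + 2) + \<bar>a (l + 2)\<bar>)"
    using jet_poly_bound_top[OF f] by auto
  obtain C2 where C2: "C2 \<ge> 0" "\<And>a \<kappa> \<mu>. \<kappa> \<ge> 0 \<Longrightarrow> \<mu> \<ge> 0 \<Longrightarrow>
      (\<And>i. i \<le> l \<Longrightarrow> \<bar>a i\<bar> \<le> \<kappa> * \<mu> ^ i) \<Longrightarrow> \<bar>g a\<bar> \<le> C2 * \<kappa> ^ 5 * \<mu> ^ l"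
    using jet_poly_bound[OF g] by blast
  define B where "B = W + A"
  define K where "K = C1 * B ^ 3 + C1 * B ^ 2 + C2 * B ^ 5"
  define K' where "K' = A\<^sup>2 + K\<^sup>2 + K\<^sup>2 * A\<^sup>2 + (c + 1) * A\<^sup>2"
  define C where "C = A\<^sup>2 + K' * (K' / A\<^sup>2) ^ (2 * l + 1)"
  have "B > 0" using assms by (simp add: B_def)
  have "K \<ge> 0" using C1 C2 \<open>B > 0\<close> by (simp add: K_def)
  have "K' \<ge> 0" using \<open>c \<ge> 0\<close> by (simp add: K'_def)
  show thesis
  proof (rule that)
    fix b \<sigma>
    assume "unit_jet b \<sigma>"
    then interpret unit_jet b \<sigma> .
    assume W: "\<bar>J (b 0)\<bar> \<le> W" and A: "J (\<lambda>u. (b 1 u)\<^sup>2) \<le> A\<^sup>2"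
    have "n 1 \<le> A"
      unfolding n_def using A \<open>A > 0\<close> by (intro real_le_lsqrt) auto
    then obtain \<mu> where \<mu>: "\<mu> \<ge> 1"
      and n_le: "\<And>i. 1 \<le> i \<Longrightarrow> i \<le> l + 2 \<Longrightarrow> n i \<le> A * \<mu> ^ (i - 1)"
      and top: "A\<^sup>2 * \<mu> ^ (2 * l + 2) \<le> A\<^sup>2 + (n (l + 2))\<^sup>2"
      using interpolation_scale \<open>A > 0\<close> by blast
    have sup: "\<bar>b i u\<bar> \<le> B * \<mu> ^ i" if "i \<le> l + 1" "u \<in> {0..1}" for i u
    proof (cases i)
      case 0
      then show ?thesis using sup_le[OF that(2), of 0] W \<open>n 1 \<le> A\<close> by (simp add: B_def)
    next
      case (Suc j)
      then have "\<bar>b i u\<bar> \<le> A * \<mu> ^ i"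
        using sup_derivative_le[OF that(2), of j] n_le[of "Suc i"] that by simp
      also have "\<dots> \<le> B * \<mu> ^ i"
        using \<open>W \<ge> 0\<close> \<mu> by (intro mult_right_mono) (auto simp: B_def)
      finally show ?thesis .
    qed
    define X where "X u = f (\<lambda>i. b i u) + g (\<lambda>i. b i u)" for u
    have X_cont: "continuous_on S X" for S
      unfolding X_def by (intro continuous_intros continuous_on_jet_poly[OF f] continuous_on_jet_poly[OF g])
    have X_le: "\<bar>X u\<bar> \<le> K * (\<mu> ^ (l + 2) + \<bar>b (l + 2) u\<bar>)" if u: "u \<in> {0..1}" for u
    proof -
      let ?d = "\<bar>b (l + 2) u\<bar>"
      have "\<bar>f (\<lambda>i. b i u)\<bar> \<le> C1 * B ^ (3 - 1) * (B * \<mu> ^ (l + 2) + ?d)"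
        using sup u \<open>B > 0\<close> \<mu> by (intro C1) auto
      moreover have "\<bar>g (\<lambda>i. b i u)\<bar> \<le> C2 * B ^ 5 * \<mu> ^ l"
        using sup u \<open>B > 0\<close> \<mu> by (intro C2) auto
      moreover have "C2 * B ^ 5 * \<mu> ^ l \<le> C2 * B ^ 5 * \<mu> ^ (l + 2)"
        using \<mu> C2 \<open>B > 0\<close> by (intro mult_left_mono power_increasing) auto
      moreover have "0 \<le> C1 * B ^ 3 * ?d" "0 \<le> C1 * B ^ 2 * \<mu> ^ (l + 2)" "0 \<le> C2 * B ^ 5 * ?d"
        using \<mu> C1 C2 \<open>B > 0\<close> by auto
      ultimately show ?thesis
        unfolding X_def K_def by (simp add: algebra_simps power3_eq_cube power2_eq_square)
    qed
    \<comment> \<open>The weight \<open>\<mu>\<^sup>3\<close> in Young's inequality balances the orders of \<open>b l\<close> and \<open>X\<close>, which differ by \<open>\<mu>\<^sup>3\<close>.\<close>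
    have product_le: "b l u * X u \<le> \<mu> ^ 3 * (b l u)\<^sup>2 + (K\<^sup>2 * \<mu> ^ (2 * l + 1) + K\<^sup>2 / \<mu> ^ 3 * (b (l + 2) u)\<^sup>2)"
      if u: "u \<in> {0..1}" for u
    proof -
      let ?d = "\<bar>b (l + 2) u\<bar>"
      have "(X u)\<^sup>2 \<le> (K * (\<mu> ^ (l + 2) + ?d))\<^sup>2"
        using power_mono[OF X_le[OF u], of 2] by simp
      also have "\<dots> \<le> 2 * K\<^sup>2 * (\<mu> ^ (2 * l + 4) + (b (l + 2) u)\<^sup>2)"
      proof -
        have "(\<mu> ^ (l + 2) + ?d)\<^sup>2 \<le> 2 * ((\<mu> ^ (l + 2))\<^sup>2 + ?d\<^sup>2)"
          using sum_squares_bound[of "\<mu> ^ (l + 2)" ?d] by (simp add: power2_sum)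
        also have "(\<mu> ^ (l + 2))\<^sup>2 = \<mu> ^ ((l + 2) * 2)" by (rule power_mult[symmetric])
        also have "(l + 2) * 2 = 2 * l + 4" by simp
        finally have "K\<^sup>2 * (\<mu> ^ (l + 2) + ?d)\<^sup>2 \<le> K\<^sup>2 * (2 * (\<mu> ^ (2 * l + 4) + ?d\<^sup>2))"
          by (intro mult_left_mono) auto
        then show ?thesis unfolding power_mult_distrib power2_abs by (simp only: mult_ac)
      qed
      finally have X2: "(X u)\<^sup>2 / (2 * \<mu> ^ 3) \<le> K\<^sup>2 * (\<mu> ^ (2 * l + 4) + (b (l + 2) u)\<^sup>2) / \<mu> ^ 3"
        using \<mu> by (simp add: divide_simps)
      have "\<mu> ^ (2 * l + 4) / \<mu> ^ 3 = \<mu> ^ (2 * l + 1)"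
      proof -
        have e: "2 * l + 4 = (2 * l + 1) + 3" by simp
        have "\<mu> ^ (2 * l + 4) = \<mu> ^ (2 * l + 1) * \<mu> ^ 3" unfolding e by (rule power_add)
        then show ?thesis using \<mu> by simp
      qed
      then have X2': "(X u)\<^sup>2 / (2 * \<mu> ^ 3) \<le> K\<^sup>2 * \<mu> ^ (2 * l + 1) + K\<^sup>2 / \<mu> ^ 3 * (b (l + 2) u)\<^sup>2"
        using X2 by (simp add: distrib_left add_divide_distrib times_divide_eq_right[symmetric] del: times_divide_eq_right)
      have "0 \<le> (2 * \<mu> ^ 3 * b l u - X u)\<^sup>2 + (X u)\<^sup>2" by simp
      then have "4 * \<mu> ^ 3 * (b l u * X u) \<le> 4 * \<mu> ^ 3 * (\<mu> ^ 3 * (b l u)\<^sup>2 + (X u)\<^sup>2 / (2 * \<mu> ^ 3))"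
        using \<mu> by (simp add: power2_eq_square algebra_simps)
      then have "b l u * X u \<le> \<mu> ^ 3 * (b l u)\<^sup>2 + (X u)\<^sup>2 / (2 * \<mu> ^ 3)"
        using \<mu> by (subst (asm) mult_le_cancel_left_pos) auto
      with X2' show ?thesis by simp
    qed
    have n_l: "(n l)\<^sup>2 \<le> A\<^sup>2 * \<mu> ^ (2 * l - 2)"
    proof -
      have "(n l)\<^sup>2 \<le> (A * \<mu> ^ (l - 1))\<^sup>2"
        using n_le[of l] \<open>l \<ge> 1\<close> by (intro power_mono n_nonneg) auto
      also have "\<dots> = A\<^sup>2 * \<mu> ^ ((l - 1) * 2)"
        unfolding power_mult_distrib power_mult ..
      also have "(l - 1) * 2 = 2 * l - 2" by simp
      finally show ?thesis .
    qed
    have n_top: "(n (l + 2))\<^sup>2 \<le> A\<^sup>2 * \<mu> ^ (2 * l + 2)"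
    proof -
      have "(n (l + 2))\<^sup>2 \<le> (A * \<mu> ^ (l + 1))\<^sup>2"
        using n_le[of "l + 2"] by (intro power_mono n_nonneg) auto
      also have "\<dots> = A\<^sup>2 * \<mu> ^ ((l + 1) * 2)"
        unfolding power_mult_distrib power_mult ..
      also have "(l + 1) * 2 = 2 * l + 2" by simp
      finally show ?thesis .
    qed
    have "J (\<lambda>u. b l u * X u) \<le> J (\<lambda>u. \<mu> ^ 3 * (b l u)\<^sup>2 + (K\<^sup>2 * \<mu> ^ (2 * l + 1) + K\<^sup>2 / \<mu> ^ 3 * (b (l + 2) u)\<^sup>2))"
      by (intro J_mono continuous_intros X_cont product_le) auto
    also have "\<dots> = \<mu> ^ 3 * (n l)\<^sup>2 + (K\<^sup>2 * \<mu> ^ (2 * l + 1) + K\<^sup>2 / \<mu> ^ 3 * (n (l + 2))\<^sup>2)"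
      unfolding n_squared by (subst J_add J_cmult J_const; (intro continuous_intros)?)+ simp
    also have "\<mu> ^ 3 * (n l)\<^sup>2 \<le> \<mu> ^ 3 * (A\<^sup>2 * \<mu> ^ (2 * l - 2))"
      using \<mu> by (intro mult_left_mono n_l) auto
    also have "\<mu> ^ 3 * (A\<^sup>2 * \<mu> ^ (2 * l - 2)) = A\<^sup>2 * \<mu> ^ (2 * l + 1)"
    proof -
      have "3 + (2 * l - 2) = 2 * l + 1" using \<open>l \<ge> 1\<close> by simp
      then have "\<mu> ^ (2 * l + 1) = \<mu> ^ 3 * \<mu> ^ (2 * l - 2)" by (metis power_add)
      then show ?thesis by simp
    qed
    also have "K\<^sup>2 / \<mu> ^ 3 * (n (l + 2))\<^sup>2 \<le> K\<^sup>2 * (A\<^sup>2 * \<mu> ^ (2 * l + 1))"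
    proof -
      have "K\<^sup>2 / \<mu> ^ 3 * (n (l + 2))\<^sup>2 \<le> K\<^sup>2 / \<mu> ^ 3 * (A\<^sup>2 * \<mu> ^ (2 * l + 2))"
        using \<mu> by (intro mult_left_mono n_top) auto
      also have "\<dots> \<le> K\<^sup>2 / \<mu> * (A\<^sup>2 * \<mu> ^ (2 * l + 2))"
        using \<mu> by (intro mult_right_mono divide_left_mono) (auto intro: self_le_power)
      also have "\<dots> = K\<^sup>2 * (A\<^sup>2 * \<mu> ^ (2 * l + 1))" using \<mu> by simp
      finally show ?thesis .
    qed
    finally have X_int: "J (\<lambda>u. b l u * X u) \<le> (A\<^sup>2 + K\<^sup>2 + K\<^sup>2 * A\<^sup>2) * \<mu> ^ (2 * l + 1)"
      by (simp add: algebra_simps)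
    have low: "(c + 1) * (n l)\<^sup>2 \<le> (c + 1) * A\<^sup>2 * \<mu> ^ (2 * l + 1)"
    proof -
      have "(n l)\<^sup>2 \<le> A\<^sup>2 * \<mu> ^ (2 * l + 1)"
        using n_l \<mu> by (elim order_trans) (intro mult_left_mono power_increasing; simp)
      then show ?thesis using \<open>c \<ge> 0\<close> by (simp add: mult.assoc mult_left_mono)
    qed
    \<comment> \<open>Either \<open>\<mu>\<close> is bounded by the data or the highest power of \<open>\<mu>\<close> wins.\<close>
    have absorb: "K' * \<mu> ^ (2 * l + 1) - A\<^sup>2 * \<mu> ^ (2 * l + 2) + A\<^sup>2 \<le> C"
    proof (cases "\<mu> \<le> K' / A\<^sup>2")
      case True
      then have "K' * \<mu> ^ (2 * l + 1) \<le> K' * (K' / A\<^sup>2) ^ (2 * l + 1)"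
        using \<mu> \<open>K' \<ge> 0\<close> by (intro mult_left_mono power_mono) auto
      moreover have "0 \<le> A\<^sup>2 * \<mu> ^ (2 * l + 2)" using \<mu> by auto
      ultimately show ?thesis unfolding C_def by linarith
    next
      case False
      then have "K' \<le> A\<^sup>2 * \<mu>" using \<open>A > 0\<close> by (simp add: field_simps)
      then have "K' * \<mu> ^ (2 * l + 1) \<le> A\<^sup>2 * \<mu> * \<mu> ^ (2 * l + 1)"
        using \<mu> by (intro mult_right_mono) auto
      moreover have "0 \<le> K' * (K' / A\<^sup>2) ^ (2 * l + 1)" using \<open>K' \<ge> 0\<close> by simp
      ultimately show ?thesis unfolding C_def by (simp add: mult_ac)
    qed
    have "J (\<lambda>u. b l u * b (l + 4) u) = (n (l + 2))\<^sup>2"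
      using integration_by_parts[of "l + 3" l] integration_by_parts[of "l + 2" "Suc l"]
      unfolding n_squared by (simp add: power2_eq_square mult.commute numeral_eq_Suc)
    moreover have "K' * \<mu> ^ (2 * l + 1) = (A\<^sup>2 + K\<^sup>2 + K\<^sup>2 * A\<^sup>2) * \<mu> ^ (2 * l + 1) + (c + 1) * A\<^sup>2 * \<mu> ^ (2 * l + 1)"
      unfolding K'_def by (rule distrib_right)
    moreover have "(c + 1) * (n l)\<^sup>2 = c * (n l)\<^sup>2 + (n l)\<^sup>2" by (simp add: distrib_right)
    ultimately show "c * J (\<lambda>u. (b l u)\<^sup>2) - 2 * J (\<lambda>u. b l u * b (l + 4) u)
        + J (\<lambda>u. b l u * (f (\<lambda>i. b i u) + g (\<lambda>i. b i u))) \<le> C - J (\<lambda>u. (b l u)\<^sup>2)"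
      using X_int low absorb top zero_le_power2[of "n (l + 2)"]
      unfolding X_def[symmetric] n_squared[symmetric] by linarith
  qed
qed


section \<open>Algebra of smooth families\<close>

lemma C_k_family_continuous: "C_k_family n f \<Longrightarrow> continuous_on ({0..} \<times> UNIV) (\<lambda>(t, u). f t u)"
  by (cases n) auto

lemma C_k_family_SucD: "C_k_family (Suc n) f \<Longrightarrow> C_k_family n f"
proof (induction n arbitrary: f)
  case (Suc n)
  then show ?case by (subst C_k_family.simps) (auto dest!: Suc.IH simp del: C_k_family.simps(2) simp: C_k_family.simps(2)[of "Suc n"])
qed simp

lemma C_k_family_SucI:
  assumes "\<And>t u. t \<ge> 0 \<Longrightarrow> ((\<lambda>s. f s u) has_vector_derivative f_t t u) (at t within {0..})"
    and "\<And>t u. t \<ge> 0 \<Longrightarrow> (f t has_vector_derivative f_u t u) (at u)"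
    and "C_k_family n f" "C_k_family n f_t" "C_k_family n f_u"
  shows "C_k_family (Suc n) f"
  unfolding C_k_family.simps using assms C_k_family_continuous[OF assms(3)]
  by (intro conjI exI[of _ f_t] exI[of _ f_u]) auto

lemma C_k_family_SucE:
  assumes "C_k_family (Suc n) f"
  obtains f_t f_u where
    "\<And>t u. t \<ge> 0 \<Longrightarrow> ((\<lambda>s. f s u) has_vector_derivative f_t t u) (at t within {0..})"
    "\<And>t u. t \<ge> 0 \<Longrightarrow> (f t has_vector_derivative f_u t u) (at u)"
    "C_k_family n f" "C_k_family n f_t" "C_k_family n f_u"
  using assms C_k_family_SucD[OF assms] by (auto simp: eta_contract_eq)

text \<open>
  Smoothness is a property of the restriction to times \<open>t \<ge> 0\<close>, and only there are the derivatives
  determined: different witnesses for \<open>f_t\<close> and \<open>f_u\<close> may disagree at negative times.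
\<close>

lemma C_k_family_cong:
  assumes "\<And>t u. t \<ge> 0 \<Longrightarrow> f t u = g t u" and "C_k_family n f"
  shows "C_k_family n g"
  using assms
proof (induction n arbitrary: f g)
  case 0
  then show ?case by (auto elim!: continuous_on_eq)
next
  case (Suc n)
  from Suc.prems(2) obtain f_t f_u where *:
    "\<And>t u. t \<ge> 0 \<Longrightarrow> ((\<lambda>s. f s u) has_vector_derivative f_t t u) (at t within {0..})"
    "\<And>t u. t \<ge> 0 \<Longrightarrow> (f t has_vector_derivative f_u t u) (at u)"
    "C_k_family n f" "C_k_family n f_t" "C_k_family n f_u"
    by (rule C_k_family_SucE) blast
  show ?case
  proof (rule C_k_family_SucI)
    fix t u :: real
    assume "t \<ge> 0"
    then show "((\<lambda>s. g s u) has_vector_derivative f_t t u) (at t within {0..})"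
      using has_vector_derivative_transform[OF _ _ *(1)[of t u], of "\<lambda>s. g s u"] Suc.prems(1) by simp
    have "f t = g t" using Suc.prems(1) \<open>t \<ge> 0\<close> by auto
    then show "(g t has_vector_derivative f_u t u) (at u)" using *(2)[OF \<open>t \<ge> 0\<close>] by simp
  qed (use * Suc in blast)+
qed

lemma C_k_family_const: "C_k_family n (\<lambda>t u. c)"
proof (induction n arbitrary: c)
  case (Suc n)
  show ?case by (rule C_k_family_SucI[where f_t = "\<lambda>t u. 0" and f_u = "\<lambda>t u. 0"]) (auto intro: Suc)
qed (simp add: split_def)

lemma C_k_family_add:
  assumes "C_k_family n f" "C_k_family n g"
  shows "C_k_family n (\<lambda>t u. f t u + g t u)"
  using assms
proof (induction n arbitrary: f g)
  case 0
  then show ?case by (auto simp: split_def intro: continuous_on_add)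
next
  case (Suc n)
  from Suc.prems(1) obtain f_t f_u where f:
    "\<And>t u. t \<ge> 0 \<Longrightarrow> ((\<lambda>s. f s u) has_vector_derivative f_t t u) (at t within {0..})"
    "\<And>t u. t \<ge> 0 \<Longrightarrow> (f t has_vector_derivative f_u t u) (at u)"
    "C_k_family n f" "C_k_family n f_t" "C_k_family n f_u"
    by (rule C_k_family_SucE) blast
  from Suc.prems(2) obtain g_t g_u where g:
    "\<And>t u. t \<ge> 0 \<Longrightarrow> ((\<lambda>s. g s u) has_vector_derivative g_t t u) (at t within {0..})"
    "\<And>t u. t \<ge> 0 \<Longrightarrow> (g t has_vector_derivative g_u t u) (at u)"
    "C_k_family n g" "C_k_family n g_t" "C_k_family n g_u"
    by (rule C_k_family_SucE) blast
  show ?case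
    by (rule C_k_family_SucI[where f_t = "\<lambda>t u. f_t t u + g_t t u" and f_u = "\<lambda>t u. f_u t u + g_u t u"])
      (auto intro!: has_vector_derivative_add f g Suc.IH)
qed

text \<open>
  The derivatives of a product are sums of products of functions of class \<open>n\<close>, which is all that the
  induction needs; one proof for all bounded bilinear maps covers multiplication, scaling and the inner
  product.
\<close>

lemma C_k_family_bilinear:
  assumes "bounded_bilinear p" and "C_k_family n f" "C_k_family n g"
  shows "C_k_family n (\<lambda>t u. p (f t u) (g t u))"
  using assms(2,3)
proof (induction n arbitrary: f g)
  case 0
  then show ?case by (auto simp: split_def intro: bounded_bilinear.continuous_on[OF assms(1)])
next
  case (Suc n)
  from Suc.prems(1) obtain f_t f_u where f:
    "\<And>t u. t \<ge> 0 \<Longrightarrow> ((\<lambda>s. f s u) has_vector_derivative f_t t u) (at t within {0..})"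
    "\<And>t u. t \<ge> 0 \<Longrightarrow> (f t has_vector_derivative f_u t u) (at u)"
    "C_k_family n f" "C_k_family n f_t" "C_k_family n f_u"
    by (rule C_k_family_SucE) blast
  from Suc.prems(2) obtain g_t g_u where g:
    "\<And>t u. t \<ge> 0 \<Longrightarrow> ((\<lambda>s. g s u) has_vector_derivative g_t t u) (at t within {0..})"
    "\<And>t u. t \<ge> 0 \<Longrightarrow> (g t has_vector_derivative g_u t u) (at u)"
    "C_k_family n g" "C_k_family n g_t" "C_k_family n g_u"
    by (rule C_k_family_SucE) blast
  show ?case
    by (rule C_k_family_SucI[where f_t = "\<lambda>t u. p (f t u) (g_t t u) + p (f_t t u) (g t u)"
          and f_u = "\<lambda>t u. p (f t u) (g_u t u) + p (f_u t u) (g t u)"])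
      (auto intro!: bounded_bilinear.has_vector_derivative[OF assms(1)] f g Suc.IH C_k_family_add)
qed

lemmas C_k_family_mult = C_k_family_bilinear[OF bounded_bilinear_mult]
lemmas C_k_family_scaleR = C_k_family_bilinear[OF bounded_bilinear_scaleR]
lemmas C_k_family_inner = C_k_family_bilinear[OF bounded_bilinear_inner]

lemma C_k_family_inverse:
  fixes f :: "real \<Rightarrow> real \<Rightarrow> real"
  assumes "C_k_family n f" and nz: "\<And>t u. t \<ge> 0 \<Longrightarrow> f t u \<noteq> 0"
  shows "C_k_family n (\<lambda>t u. inverse (f t u))"
  using assms(1)
proof (induction n)
  case 0
  then show ?case using nz by (auto simp: split_def intro!: continuous_on_inverse)
next
  case (Suc n)
  from Suc.prems(1) obtain f_t f_u where f:
    "\<And>t u. t \<ge> 0 \<Longrightarrow> ((\<lambda>s. f s u) has_vector_derivative f_t t u) (at t within {0..})"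
    "\<And>t u. t \<ge> 0 \<Longrightarrow> (f t has_vector_derivative f_u t u) (at u)"
    "C_k_family n f" "C_k_family n f_t" "C_k_family n f_u"
    by (rule C_k_family_SucE) blast
  have "C_k_family n (\<lambda>t u. (-1) * (inverse (f t u) * (h t u * inverse (f t u))))" if "C_k_family n h" for h
    using Suc.IH f that by (intro C_k_family_mult C_k_family_const) auto
  then have inv: "C_k_family n (\<lambda>t u. - (inverse (f t u) * h t u * inverse (f t u)))" if "C_k_family n h" for h
    using that by (simp add: mult.assoc)
  show ?case
    by (rule C_k_family_SucI[OF _ _ _ inv[OF f(4)] inv[OF f(5)]])
      (use f Suc.IH nz in \<open>auto intro!: DERIV_inverse' simp flip: has_real_derivative_iff_has_vector_derivative\<close>)
qed

lemma C_k_family_sqrt: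
  fixes f :: "real \<Rightarrow> real \<Rightarrow> real"
  assumes "C_k_family n f" and pos: "\<And>t u. t \<ge> 0 \<Longrightarrow> f t u > 0"
  shows "C_k_family n (\<lambda>t u. sqrt (f t u))"
  using assms(1)
proof (induction n)
  case 0
  then show ?case by (auto simp: split_def intro!: continuous_on_real_sqrt)
next
  case (Suc n)
  from Suc.prems(1) obtain f_t f_u where f:
    "\<And>t u. t \<ge> 0 \<Longrightarrow> ((\<lambda>s. f s u) has_vector_derivative f_t t u) (at t within {0..})"
    "\<And>t u. t \<ge> 0 \<Longrightarrow> (f t has_vector_derivative f_u t u) (at u)"
    "C_k_family n f" "C_k_family n f_t" "C_k_family n f_u"
    by (rule C_k_family_SucE) blast
  have nz: "sqrt (f t u) \<noteq> 0" if "t \<ge> 0" for t u using pos[OF that, of u] by simp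
  have inv: "C_k_family n (\<lambda>t u. h t u * ((1/2) * inverse (sqrt (f t u))))" if "C_k_family n h" for h
    using Suc.IH f that nz by (intro C_k_family_mult C_k_family_const C_k_family_inverse) auto
  have deriv: "((\<lambda>x. sqrt (h x)) has_vector_derivative h' * ((1/2) * inverse (sqrt (h x)))) (at x within S)"
    if "(h has_vector_derivative h') (at x within S)" "h x > 0" for h h' x S
    using that
    by (auto simp flip: has_real_derivative_iff_has_vector_derivative
        intro!: derivative_eq_intros simp: divide_simps)
  show ?case
  proof (rule C_k_family_SucI[OF _ _ Suc.IH[OF f(3)] inv[OF f(4)] inv[OF f(5)]])
    fix t u :: real
    assume t: "t \<ge> 0"
    show "((\<lambda>s. sqrt (f s u)) has_vector_derivative f_t t u * ((1/2) * inverse (sqrt (f t u)))) (at t within {0..})"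
      by (rule deriv[OF f(1)[OF t] pos[OF t]])
    show "((\<lambda>u. sqrt (f t u)) has_vector_derivative f_u t u * ((1/2) * inverse (sqrt (f t u)))) (at u)"
      by (rule deriv[OF f(2)[OF t] pos[OF t]])
  qed
qed

section \<open>Partial derivatives of smooth families\<close>

definition Dt :: "(real \<Rightarrow> real \<Rightarrow> 'a::real_normed_vector) \<Rightarrow> real \<Rightarrow> real \<Rightarrow> 'a" where
  "Dt f t u = vector_derivative (\<lambda>s. f s u) (at t within {0..})"

definition Du :: "(real \<Rightarrow> real \<Rightarrow> 'a::real_normed_vector) \<Rightarrow> real \<Rightarrow> real \<Rightarrow> 'a" where
  "Du f t u = vector_derivative (f t) (at u)"

lemma at_within_atLeast_nontrivial: "(t::real) \<ge> 0 \<Longrightarrow> at t within {0..} \<noteq> bot"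
  using at_le[of "{t<..}" "{0..}" t] trivial_limit_at_right_real[of t]
  by (metis atLeast_iff bot.extremum_unique greaterThan_iff le_less_trans less_imp_le subsetI)

lemma Dt_eqI:
  assumes "((\<lambda>s. f s u) has_vector_derivative d) (at t within {0..})" "t \<ge> 0"
  shows "Dt f t u = d"
  unfolding Dt_def
  by (rule vector_derivative_within[OF at_within_atLeast_nontrivial[OF assms(2)] assms(1)])

lemma Du_eqI: "(f t has_vector_derivative d) (at u) \<Longrightarrow> Du f t u = d"
  by (simp add: Du_def vector_derivative_at)

lemma Dt_cong: "(\<And>t u. t \<ge> 0 \<Longrightarrow> f t u = g t u) \<Longrightarrow> t \<ge> 0 \<Longrightarrow> Dt f t u = Dt g t u"
  unfolding Dt_def by (rule vector_derivative_cong_eq) (auto simp: eventually_at_filter)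

lemma Du_cong: "(\<And>t u. t \<ge> 0 \<Longrightarrow> f t u = g t u) \<Longrightarrow> t \<ge> 0 \<Longrightarrow> Du f t u = Du g t u"
  unfolding Du_def by presburger

named_theorems smooth_intros

context
  fixes f :: "real \<Rightarrow> real \<Rightarrow> 'a::real_normed_vector"
  assumes f: "smooth_family f"
begin

lemma has_Dt: "t \<ge> 0 \<Longrightarrow> ((\<lambda>s. f s u) has_vector_derivative Dt f t u) (at t within {0..})"
proof -
  assume "t \<ge> 0"
  have "C_k_family (Suc 0) f" using f by (simp add: smooth_family_def del: C_k_family.simps)
  then show ?thesis using Dt_eqI[OF _ \<open>t \<ge> 0\<close>] \<open>t \<ge> 0\<close> by (metis C_k_family_SucE)
qed

lemma has_Du: "t \<ge> 0 \<Longrightarrow> (f t has_vector_derivative Du f t u) (at u)"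
proof -
  assume "t \<ge> 0"
  have "C_k_family (Suc 0) f" using f by (simp add: smooth_family_def del: C_k_family.simps)
  then show ?thesis using Du_eqI \<open>t \<ge> 0\<close> by (metis C_k_family_SucE)
qed

lemma smooth_Dt: "smooth_family (Dt f)"
  unfolding smooth_family_def
proof
  fix n
  have "C_k_family (Suc n) f" using f by (simp add: smooth_family_def del: C_k_family.simps)
  then obtain f_t f_u where
    "\<And>t u. t \<ge> 0 \<Longrightarrow> ((\<lambda>s. f s u) has_vector_derivative f_t t u) (at t within {0..})" "C_k_family n f_t"
    using C_k_family_SucE by metis
  then show "C_k_family n (Dt f)" by (auto intro!: C_k_family_cong[of f_t "Dt f"] Dt_eqI[symmetric])
qed

lemma smooth_Du: "smooth_family (Du f)"
  unfolding smooth_family_def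
proof
  fix n
  have "C_k_family (Suc n) f" using f by (simp add: smooth_family_def del: C_k_family.simps)
  then obtain f_t f_u where
    "\<And>t u. t \<ge> 0 \<Longrightarrow> (f t has_vector_derivative f_u t u) (at u)" "C_k_family n f_u"
    using C_k_family_SucE by metis
  then show "C_k_family n (Du f)" by (auto intro!: C_k_family_cong[of f_u "Du f"] Du_eqI[symmetric])
qed

lemma smooth_continuous: "continuous_on ({0..} \<times> UNIV) (\<lambda>(t, u). f t u)"
  using f C_k_family_continuous by (auto simp: smooth_family_def)

lemma smooth_continuous_time: "continuous_on {0..} (\<lambda>t. f t u)"
  by (rule continuous_on_compose2[OF smooth_continuous, of "{0..}" "\<lambda>t. (t, u)", unfolded split_conv])
    (auto intro!: continuous_intros)

lemma smooth_continuous_space: "t \<ge> 0 \<Longrightarrow> continuous_on S (f t)"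
  by (rule continuous_on_compose2[OF smooth_continuous, of S "\<lambda>u. (t, u)", unfolded split_conv])
    (auto intro!: continuous_intros)

end

lemma smooth_family_cong:
  "smooth_family f \<Longrightarrow> (\<And>t u. t \<ge> 0 \<Longrightarrow> f t u = g t u) \<Longrightarrow> smooth_family g"
  by (auto simp: smooth_family_def intro: C_k_family_cong)

lemma smooth_const [smooth_intros]: "smooth_family (\<lambda>t u. c)"
  by (simp add: smooth_family_def C_k_family_const)

lemma smooth_add [smooth_intros]:
  "smooth_family f \<Longrightarrow> smooth_family g \<Longrightarrow> smooth_family (\<lambda>t u. f t u + g t u)"
  by (simp add: smooth_family_def C_k_family_add)

lemma smooth_mult [smooth_intros]:
  fixes f g :: "real \<Rightarrow> real \<Rightarrow> 'a::real_normed_algebra"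
  shows "smooth_family f \<Longrightarrow> smooth_family g \<Longrightarrow> smooth_family (\<lambda>t u. f t u * g t u)"
  by (simp add: smooth_family_def C_k_family_mult)

lemma smooth_scaleR [smooth_intros]:
  "smooth_family f \<Longrightarrow> smooth_family g \<Longrightarrow> smooth_family (\<lambda>t u. f t u *\<^sub>R g t u)"
  by (simp add: smooth_family_def C_k_family_scaleR)

lemma smooth_inner [smooth_intros]:
  "smooth_family f \<Longrightarrow> smooth_family g \<Longrightarrow> smooth_family (\<lambda>t u. inner (f t u) (g t u))"
  by (simp add: smooth_family_def C_k_family_inner)

lemma smooth_power [smooth_intros]:
  fixes f :: "real \<Rightarrow> real \<Rightarrow> real"
  shows "smooth_family f \<Longrightarrow> smooth_family (\<lambda>t u. f t u ^ n)"
  by (induction n) (auto intro: smooth_intros)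

lemma smooth_minus [smooth_intros]:
  fixes f :: "real \<Rightarrow> real \<Rightarrow> 'a::real_normed_vector"
  assumes "smooth_family f"
  shows "smooth_family (\<lambda>t u. - f t u)"
  using smooth_scaleR[OF smooth_const[of "-1"] assms] by simp

text \<open>
  Differentiating \<open>f t u - f 0 u = \<integral>\<^sub>0\<^sup>t \<partial>\<^sub>t f\<close> under the integral sign with respect to \<open>u\<close> and then with
  respect to \<open>t\<close>.  This argument works up to the boundary \<open>t = 0\<close>, where the time derivative is one-sided.
\<close>

lemma mixed_partials_commute:
  fixes f :: "real \<Rightarrow> real \<Rightarrow> 'a::euclidean_space"
  assumes f: "smooth_family f" and "t \<ge> 0"
  shows "Dt (Du f) t u = Du (Dt f) t u"
proof (rule Dt_eqI[OF _ \<open>t \<ge> 0\<close>])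
  let ?g = "\<lambda>s. integral {0..s} (\<lambda>r. Du (Dt f) r u)"
  have fut: "continuous_on ({0..} \<times> UNIV) (\<lambda>(t, u). Du (Dt f) t u)"
    by (intro smooth_continuous smooth_Du smooth_Dt f)
  have FTC: "integral {0..s} (\<lambda>r. Dt f r v) = f s v - f 0 v" if "s \<ge> 0" for s v
    using that by (intro integral_unique fundamental_theorem_of_calculus)
      (auto intro: has_vector_derivative_within_subset[OF has_Dt[OF f]])
  have Du_eq: "?g s + Du f 0 u = Du f s u" if "s \<ge> 0" for s
  proof -
    have "((\<lambda>v. integral (cbox 0 s) (\<lambda>r. Dt f r v)) has_vector_derivative integral (cbox 0 s) (\<lambda>r. Du (Dt f) r u))
        (at u within UNIV)"
    proof (rule leibniz_rule_vector_derivative)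
      show "(\<lambda>r. Dt f r v) integrable_on cbox 0 s" for v
        by (auto intro!: integrable_continuous_real continuous_on_subset[OF smooth_continuous_time[OF smooth_Dt[OF f]]])
      show "((\<lambda>v. Dt f r v) has_vector_derivative Du (Dt f) r v) (at v within UNIV)" if "r \<in> cbox 0 s" for r v
        using has_Du[OF smooth_Dt[OF f], of r v] that by simp
      show "continuous_on (UNIV \<times> cbox 0 s) (\<lambda>(v, r). Du (Dt f) r v)"
        using continuous_on_compose2[OF fut, of "UNIV \<times> cbox 0 s" prod.swap]
        by (force simp: split_def intro: continuous_on_swap)
    qed auto
    then have "((\<lambda>v. f s v - f 0 v) has_vector_derivative ?g s) (at u)"
      using FTC[OF that] by simp
    moreover have "((\<lambda>v. f s v - f 0 v) has_vector_derivative Du f s u - Du f 0 u) (at u)"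
      using has_Du[OF f, of s u] has_Du[OF f, of 0 u] that by (intro has_vector_derivative_diff) auto
    ultimately show ?thesis using vector_derivative_unique_at by fastforce
  qed
  have "((\<lambda>s. ?g s + Du f 0 u) has_vector_derivative Du (Dt f) t u) (at t within {0..t + 1})"
    unfolding has_vector_derivative_add_const using \<open>t \<ge> 0\<close>
    by (intro integral_has_vector_derivative
        continuous_on_subset[OF smooth_continuous_time[OF smooth_Du[OF smooth_Dt[OF f]]]]) auto
  also have "at t within {0..t + 1} = at t within {0..}"
    by (rule at_within_nhd[of _ "{..<t + 1}"]) auto
  finally show "((\<lambda>s. Du f s u) has_vector_derivative Du (Dt f) t u) (at t within {0..})"
    by (rule has_vector_derivative_transform[rotated 2]) (use Du_eq \<open>t \<ge> 0\<close> in auto)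
qed

lemma integral_has_Dt:
  fixes f :: "real \<Rightarrow> real \<Rightarrow> real"
  assumes f: "smooth_family f" and "t \<ge> 0"
  shows "((\<lambda>t. integral {0..1} (f t)) has_real_derivative integral {0..1} (Dt f t)) (at t within {0..})"
proof -
  have "((\<lambda>t. integral (cbox 0 1) (f t)) has_vector_derivative integral (cbox 0 1) (Dt f t)) (at t within {0..})"
  proof (rule leibniz_rule_vector_derivative)
    show "f t integrable_on cbox 0 1" if "t \<in> {0..}" for t
      using that by (intro integrable_continuous smooth_continuous_space f) auto
    show "continuous_on ({0..} \<times> cbox 0 1) (\<lambda>(t, u). Dt f t u)"
      by (rule continuous_on_subset[OF smooth_continuous[OF smooth_Dt[OF f]]]) auto
  qed (use has_Dt[OF f] \<open>t \<ge> 0\<close> in auto)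
  then show ?thesis by (simp add: has_real_derivative_iff_has_vector_derivative)
qed


section \<open>Rules for partial derivatives\<close>

lemma Dt_bilinear:
  assumes "bounded_bilinear p" "smooth_family f" "smooth_family g" "t \<ge> 0"
  shows "Dt (\<lambda>t u. p (f t u) (g t u)) t u = p (f t u) (Dt g t u) + p (Dt f t u) (g t u)"
  by (intro Dt_eqI bounded_bilinear.has_vector_derivative assms has_Dt)

lemma Du_bilinear:
  assumes "bounded_bilinear p" "smooth_family f" "smooth_family g" "t \<ge> 0"
  shows "Du (\<lambda>t u. p (f t u) (g t u)) t u = p (f t u) (Du g t u) + p (Du f t u) (g t u)"
  by (intro Du_eqI bounded_bilinear.has_vector_derivative assms has_Du)

lemmas Dt_mult = Dt_bilinear[OF bounded_bilinear_mult]
lemmas Dt_scaleR = Dt_bilinear[OF bounded_bilinear_scaleR]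
lemmas Dt_inner = Dt_bilinear[OF bounded_bilinear_inner]

lemma Dt_const: "t \<ge> 0 \<Longrightarrow> Dt (\<lambda>t u. c) t u = 0"
  by (rule Dt_eqI) auto

lemma Du_const: "Du (\<lambda>t u. c) t u = 0"
  by (rule Du_eqI) auto

lemma Du_add:
  "smooth_family f \<Longrightarrow> smooth_family g \<Longrightarrow> t \<ge> 0 \<Longrightarrow> Du (\<lambda>t u. f t u + g t u) t u = Du f t u + Du g t u"
  by (intro Du_eqI has_vector_derivative_add has_Du)

lemma Du_periodic:
  assumes f: "smooth_family f" and per: "\<And>t u. t \<ge> 0 \<Longrightarrow> f t (u + 1) = f t u" and "t \<ge> 0"
  shows "Du f t (u + 1) = Du f t u"
proof -
  have "(f t \<circ> (\<lambda>u. u + 1) has_vector_derivative 1 *\<^sub>R Du f t (u + 1)) (at u)"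
    by (rule vector_diff_chain_at) (auto intro!: derivative_eq_intros has_Du[OF f \<open>t \<ge> 0\<close>])
  then have "(f t has_vector_derivative Du f t (u + 1)) (at u)"
    using per[OF \<open>t \<ge> 0\<close>] by (simp add: o_def)
  then show ?thesis by (rule Du_eqI[symmetric])
qed

lemma orthogonal_to_unit_complex:
  fixes w z :: complex
  assumes "inner w w = 1" "inner w z = 0"
  shows "z = inner z (\<i> * w) *\<^sub>R (\<i> * w)"
proof (rule complex_eqI)
  obtain p q x y where [simp]: "w = Complex p q" "z = Complex x y" by (metis complex.exhaust_sel)
  have unit: "p * p + q * q = 1" and orth: "p * x + q * y = 0" using assms by (auto simp: inner_complex_def)
  have "x = x * (p * p + q * q)" "y = y * (p * p + q * q)" using unit by auto
  moreover have "p * (p * x + q * y) = 0" "q * (p * x + q * y) = 0" using orth by auto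
  ultimately show "Re z = Re (inner z (\<i> * w) *\<^sub>R (\<i> * w))" "Im z = Im (inner z (\<i> * w) *\<^sub>R (\<i> * w))"
    by (simp_all add: inner_complex_def algebra_simps)
qed

section \<open>Arc length calculus along a flow\<close>

locale elastic_flow =
  fixes \<gamma> :: "real \<Rightarrow> real \<Rightarrow> complex"
  assumes flow: "free_elastic_flow \<gamma>"
begin

definition v :: "real \<Rightarrow> real \<Rightarrow> real" where "v t = speed (\<gamma> t)"

definition Ds :: "(real \<Rightarrow> real \<Rightarrow> 'a::real_normed_vector) \<Rightarrow> real \<Rightarrow> real \<Rightarrow> 'a" where
  "Ds f t = arc_deriv (\<gamma> t) (f t)"

definition k :: "nat \<Rightarrow> real \<Rightarrow> real \<Rightarrow> real" where "k i t = curvature_deriv (\<gamma> t) i"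

definition \<tau> :: "real \<Rightarrow> real \<Rightarrow> complex" where "\<tau> t = tangent (\<gamma> t)"

definition \<nu> :: "real \<Rightarrow> real \<Rightarrow> complex" where "\<nu> t u = \<i> * \<tau> t u"

text \<open>
  The flow is \<open>\<partial>\<^sub>t \<gamma> = - F \<nu>\<close>.
\<close>

definition F :: "real \<Rightarrow> real \<Rightarrow> real" where "F t u = k 2 t u + 1/2 * k 0 t u ^ 3"

lemma smooth_\<gamma> [smooth_intros]: "smooth_family \<gamma>"
  and \<gamma>_periodic: "t \<ge> 0 \<Longrightarrow> \<gamma> t (u + 1) = \<gamma> t u"
  and \<gamma>_immersed: "t \<ge> 0 \<Longrightarrow> Du \<gamma> t u \<noteq> 0"
  using flow by (auto simp: free_elastic_flow_def Du_def)

lemma v_eq: "v t u = norm (Du \<gamma> t u)"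
  by (simp add: v_def speed_def Du_def)

lemma v_pos: "t \<ge> 0 \<Longrightarrow> v t u > 0"
  using \<gamma>_immersed by (simp add: v_eq)

lemma smooth_v [smooth_intros]: "smooth_family v"
proof -
  have "smooth_family (\<lambda>t u. inner (Du \<gamma> t u) (Du \<gamma> t u))"
    by (intro smooth_intros smooth_Du)
  then have "smooth_family (\<lambda>t u. sqrt (inner (Du \<gamma> t u) (Du \<gamma> t u)))"
    using \<gamma>_immersed by (auto simp: smooth_family_def intro!: C_k_family_sqrt)
  then show ?thesis
    by (rule smooth_family_cong) (simp add: v_eq norm_eq_sqrt_inner)
qed

lemma Ds_eq: "Ds f t u = inverse (v t u) *\<^sub>R Du f t u"
  by (simp add: Ds_def arc_deriv_def v_def Du_def)

lemma Du_eq: "t \<ge> 0 \<Longrightarrow> Du f t u = v t u *\<^sub>R Ds f t u"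
  using v_pos[of t u] by (simp add: Ds_eq)

lemma smooth_Ds [smooth_intros]:
  assumes "smooth_family f" shows "smooth_family (Ds f)"
proof -
  have "smooth_family (\<lambda>t u. inverse (v t u))"
    using smooth_v v_pos less_irrefl unfolding smooth_family_def by (metis C_k_family_inverse)
  then have "smooth_family (\<lambda>t u. inverse (v t u) *\<^sub>R Du f t u)"
    by (intro smooth_intros smooth_Du assms)
  then show ?thesis by (rule smooth_family_cong) (simp add: Ds_eq)
qed

lemma Ds_bilinear:
  assumes p: "bounded_bilinear p" and "smooth_family f" "smooth_family g" "t \<ge> 0"
  shows "Ds (\<lambda>t u. p (f t u) (g t u)) t u = p (f t u) (Ds g t u) + p (Ds f t u) (g t u)"
  unfolding Ds_eq Du_bilinear[OF assms]
  by (simp add: scaleR_right_distrib bounded_bilinear.scaleR_right[OF p] bounded_bilinear.scaleR_left[OF p])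

lemmas Ds_mult = Ds_bilinear[OF bounded_bilinear_mult]
lemmas Ds_scaleR = Ds_bilinear[OF bounded_bilinear_scaleR]
lemmas Ds_inner = Ds_bilinear[OF bounded_bilinear_inner]

lemma Ds_const: "Ds (\<lambda>t u. c) t u = 0"
  by (simp add: Ds_eq Du_const)

lemma Ds_add:
  "smooth_family f \<Longrightarrow> smooth_family g \<Longrightarrow> t \<ge> 0 \<Longrightarrow> Ds (\<lambda>t u. f t u + g t u) t u = Ds f t u + Ds g t u"
  by (simp add: Ds_eq Du_add scaleR_right_distrib)

lemma Ds_minus:
  assumes "smooth_family f" "t \<ge> 0" shows "Ds (\<lambda>t u. - f t u) t u = - Ds f t u"
  using Ds_scaleR[OF smooth_const assms(1,2), of "-1" u] by (simp add: Ds_const)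

lemma Ds_cong: "(\<And>t u. t \<ge> 0 \<Longrightarrow> f t u = g t u) \<Longrightarrow> t \<ge> 0 \<Longrightarrow> Ds f t u = Ds g t u"
  by (simp add: Ds_eq Du_cong[of f g])

lemma Ds_periodic:
  assumes "smooth_family f" and "\<And>t u. t \<ge> 0 \<Longrightarrow> f t (u + 1) = f t u" and "t \<ge> 0"
  shows "Ds f t (u + 1) = Ds f t u"
  using Du_periodic[OF assms] Du_periodic[OF smooth_\<gamma> \<gamma>_periodic \<open>t \<ge> 0\<close>]
  by (simp add: Ds_eq v_eq)

section \<open>Frenet equations\<close>

lemma \<tau>_eq: "\<tau> = Ds \<gamma>"
  by (simp add: fun_eq_iff \<tau>_def tangent_def Ds_def)

lemma smooth_\<tau> [smooth_intros]: "smooth_family \<tau>"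
  unfolding \<tau>_eq by (intro smooth_intros)

lemma smooth_\<nu> [smooth_intros]: "smooth_family \<nu>"
proof -
  have "smooth_family (\<lambda>t u. \<i> * \<tau> t u)" by (intro smooth_intros)
  then show ?thesis by (rule smooth_family_cong) (simp add: \<nu>_def)
qed

lemma \<tau>_unit: "t \<ge> 0 \<Longrightarrow> inner (\<tau> t u) (\<tau> t u) = 1"
  using v_pos[of t u] \<gamma>_immersed[of t u]
  by (simp add: \<tau>_eq Ds_eq v_eq dot_square_norm power2_eq_square)

lemma k_0: "k 0 t u = inner (Ds \<tau> t u) (\<nu> t u)"
  by (simp add: k_def curvature_deriv_def curvature_def \<tau>_eq Ds_def normal_def \<nu>_def tangent_def \<tau>_def)

lemma k_Suc: "k (Suc i) = Ds (k i)"
  by (simp add: fun_eq_iff k_def curvature_deriv_def Ds_def)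

lemma smooth_k [smooth_intros]: "smooth_family (k i)"
proof (induction i)
  case 0
  have "smooth_family (\<lambda>t u. inner (Ds \<tau> t u) (\<nu> t u))" by (intro smooth_intros)
  then show ?case by (rule smooth_family_cong) (simp add: k_0)
qed (simp add: k_Suc smooth_Ds)

lemma smooth_F [smooth_intros]: "smooth_family F"
proof -
  have "smooth_family (\<lambda>t u. k 2 t u + 1/2 * k 0 t u ^ 3)" by (intro smooth_intros)
  then show ?thesis by (rule smooth_family_cong) (simp add: F_def)
qed

lemma Ds_\<tau>:
  assumes "t \<ge> 0" shows "Ds \<tau> t u = k 0 t u *\<^sub>R \<nu> t u"
proof -
  have "Ds (\<lambda>t u. inner (\<tau> t u) (\<tau> t u)) t u = Ds (\<lambda>t u. 1) t u"
    using \<tau>_unit by (intro Ds_cong assms)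
  then have "inner (\<tau> t u) (Ds \<tau> t u) = 0"
    by (simp add: Ds_inner smooth_intros assms Ds_const inner_commute)
  with orthogonal_to_unit_complex[OF \<tau>_unit[OF assms]] show ?thesis
    unfolding k_0 \<nu>_def by blast
qed

lemma Ds_\<nu>:
  assumes "t \<ge> 0" shows "Ds \<nu> t u = - (k 0 t u *\<^sub>R \<tau> t u)"
proof -
  have "Ds \<nu> t u = Ds (\<lambda>t u. \<i> * \<tau> t u) t u" using assms by (intro Ds_cong) (simp add: \<nu>_def)
  also have "\<dots> = \<i> * Ds \<tau> t u"
    by (simp add: Ds_mult smooth_intros assms Ds_const)
  also have "\<dots> = - (k 0 t u *\<^sub>R \<tau> t u)"
    by (simp add: Ds_\<tau>[OF assms] \<nu>_def)
  finally show ?thesis .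
qed

lemma k_periodic: "t \<ge> 0 \<Longrightarrow> k i t (u + 1) = k i t u"
proof (induction i arbitrary: t u)
  case 0
  have \<tau>: "\<tau> t (u + 1) = \<tau> t u" if "t \<ge> 0" for t u
    unfolding \<tau>_eq by (intro Ds_periodic smooth_\<gamma> \<gamma>_periodic that)
  moreover have "Ds \<tau> t (u + 1) = Ds \<tau> t u" by (intro Ds_periodic smooth_\<tau> \<tau> 0)
  ultimately show ?case using 0 by (simp add: k_0 \<nu>_def)
next
  case (Suc i)
  then show ?case unfolding k_Suc by (intro Ds_periodic smooth_k) auto
qed

lemma k_deriv: "t \<ge> 0 \<Longrightarrow> (k i t has_real_derivative v t u * k (Suc i) t u) (at u)"
  using has_Du[OF smooth_k, of t i u] Du_eq[of t "k i" u]
  by (simp add: has_real_derivative_iff_has_vector_derivative k_Suc)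

section \<open>Evolution equations\<close>

lemma Dt_\<gamma>: "t \<ge> 0 \<Longrightarrow> Dt \<gamma> t u = (- F t u) *\<^sub>R \<nu> t u"
  using flow by (intro Dt_eqI)
    (auto simp: free_elastic_flow_def F_def k_def curvature_deriv_def \<nu>_def normal_def \<tau>_def)

lemma Ds_Dt_\<gamma>:
  assumes "t \<ge> 0"
  shows "Ds (Dt \<gamma>) t u = (k 0 t u * F t u) *\<^sub>R \<tau> t u - Ds F t u *\<^sub>R \<nu> t u"
proof -
  have "Ds (Dt \<gamma>) t u = Ds (\<lambda>t u. - (F t u *\<^sub>R \<nu> t u)) t u"
    using assms by (intro Ds_cong) (simp_all add: Dt_\<gamma>)
  also have "\<dots> = - (F t u *\<^sub>R Ds \<nu> t u + Ds F t u *\<^sub>R \<nu> t u)"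
    by (simp add: Ds_minus Ds_scaleR smooth_intros assms Ds_const)
  finally show ?thesis by (simp add: Ds_\<nu> assms mult.commute)
qed

text \<open>
  Half the time derivative of \<open>\<bar>\<partial>\<^sub>u \<gamma>\<bar>\<^sup>2\<close>, with \<open>\<partial>\<^sub>t \<partial>\<^sub>u \<gamma> = \<partial>\<^sub>u (- F \<nu>)\<close>; only the tangential part \<open>k F v \<tau>\<close> of the
  latter contributes.
\<close>

lemma Dt_v:
  assumes "t \<ge> 0" shows "Dt v t u = k 0 t u * F t u * v t u"
proof -
  have "Dt (\<lambda>t u. v t u * v t u) t u = Dt (\<lambda>t u. inner (Du \<gamma> t u) (Du \<gamma> t u)) t u"
    using assms by (intro Dt_cong) (simp_all add: v_eq dot_square_norm power2_eq_square)
  then have "v t u * Dt v t u = inner (Du \<gamma> t u) (Dt (Du \<gamma>) t u)"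
    by (simp add: Dt_mult Dt_inner smooth_intros smooth_Du assms inner_commute mult.commute)
  also have "Dt (Du \<gamma>) t u = v t u *\<^sub>R Ds (Dt \<gamma>) t u"
    by (simp add: mixed_partials_commute smooth_intros assms Du_eq)
  also have "Du \<gamma> t u = v t u *\<^sub>R \<tau> t u"
    by (simp add: Du_eq assms \<tau>_eq)
  also have "inner (v t u *\<^sub>R \<tau> t u) (v t u *\<^sub>R Ds (Dt \<gamma>) t u) = v t u * (k 0 t u * F t u * v t u)"
  proof -
    have "inner (\<tau> t u) (\<nu> t u) = 0"
      by (simp add: \<nu>_def inner_complex_def)
    then show ?thesis
      by (simp add: Ds_Dt_\<gamma> assms inner_diff_right \<tau>_unit)
  qed
  finally show ?thesis using v_pos[OF assms, of u] by simp
qed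

text \<open>
  The commutator comes from the time dependence of the arc length element: differentiate
  \<open>v \<partial>\<^sub>s f = \<partial>\<^sub>u f\<close> in time and use that \<open>\<partial>\<^sub>t\<close> and \<open>\<partial>\<^sub>u\<close> commute.
\<close>

lemma Dt_Ds:
  fixes f :: "real \<Rightarrow> real \<Rightarrow> 'a::euclidean_space"
  assumes f: "smooth_family f" and t: "t \<ge> 0"
  shows "Dt (Ds f) t u = Ds (Dt f) t u - (k 0 t u * F t u) *\<^sub>R Ds f t u"
proof -
  have "Dt (\<lambda>t u. v t u *\<^sub>R Ds f t u) t u = Dt (Du f) t u"
    using t by (intro Dt_cong) (simp_all add: Du_eq)
  then have "v t u *\<^sub>R Dt (Ds f) t u + Dt v t u *\<^sub>R Ds f t u = v t u *\<^sub>R Ds (Dt f) t u"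
    by (simp add: Dt_scaleR smooth_intros f t mixed_partials_commute Du_eq)
  then have "v t u *\<^sub>R Dt (Ds f) t u = v t u *\<^sub>R (Ds (Dt f) t u - (k 0 t u * F t u) *\<^sub>R Ds f t u)"
    by (simp add: Dt_v t scaleR_right_diff_distrib mult.commute eq_diff_eq)
  then show ?thesis using v_pos[OF t, of u] by simp
qed

lemma Dt_\<tau>:
  assumes "t \<ge> 0" shows "Dt \<tau> t u = (- Ds F t u) *\<^sub>R \<nu> t u"
  using Dt_Ds[OF smooth_\<gamma> assms, of u] by (simp add: Ds_Dt_\<gamma> assms \<tau>_eq)

lemma Dt_curvature:
  assumes t: "t \<ge> 0" shows "Dt (k 0) t u = - Ds (Ds F) t u - (k 0 t u)\<^sup>2 * F t u"
proof -
  have orth: "inner (\<nu> t u) (\<tau> t u) = 0" by (simp add: \<nu>_def inner_complex_def)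
  have \<nu>_unit: "inner (\<nu> t u) (\<nu> t u) = 1"
    using \<tau>_unit[OF t, of u] by (simp add: \<nu>_def inner_complex_def)
  have "Dt \<nu> t u = Dt (\<lambda>t u. \<i> * \<tau> t u) t u" using t by (intro Dt_cong) (simp_all add: \<nu>_def)
  also have "\<dots> = Ds F t u *\<^sub>R \<tau> t u"
    by (simp add: Dt_mult smooth_intros t Dt_const Dt_\<tau> \<nu>_def)
  finally have Dt_\<nu>: "Dt \<nu> t u = Ds F t u *\<^sub>R \<tau> t u" .
  have "Ds (Dt \<tau>) t u = Ds (\<lambda>t u. - (Ds F t u *\<^sub>R \<nu> t u)) t u"
    using t by (intro Ds_cong) (simp_all add: Dt_\<tau>)
  also have "\<dots> = - (Ds F t u *\<^sub>R Ds \<nu> t u + Ds (Ds F) t u *\<^sub>R \<nu> t u)"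
    by (simp add: Ds_minus Ds_scaleR smooth_intros t Ds_const)
  finally have "Ds (Dt \<tau>) t u = (k 0 t u * Ds F t u) *\<^sub>R \<tau> t u - Ds (Ds F) t u *\<^sub>R \<nu> t u"
    by (simp add: Ds_\<nu> t mult.commute)
  with Dt_Ds[OF smooth_\<tau> t, of u] have Dt_Ds_\<tau>:
    "Dt (Ds \<tau>) t u = (k 0 t u * Ds F t u) *\<^sub>R \<tau> t u - Ds (Ds F) t u *\<^sub>R \<nu> t u - ((k 0 t u)\<^sup>2 * F t u) *\<^sub>R \<nu> t u"
    by (simp add: Ds_\<tau> t power2_eq_square mult_ac)
  have "Dt (k 0) t u = Dt (\<lambda>t u. inner (Ds \<tau> t u) (\<nu> t u)) t u"
    using t by (intro Dt_cong) (simp_all add: k_0)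
  also have "\<dots> = inner (Ds \<tau> t u) (Dt \<nu> t u) + inner (Dt (Ds \<tau>) t u) (\<nu> t u)"
    by (simp add: Dt_inner smooth_intros t)
  finally show ?thesis
    unfolding Dt_\<nu> Dt_Ds_\<tau> Ds_\<tau>[OF t]
    using orth \<nu>_unit by (simp add: inner_diff_left inner_commute[of "\<tau> t u"])
qed

lemma Ds_jet_poly:
  assumes "total_derivative f g"
    and "t \<ge> 0"
  shows "Ds (\<lambda>t u. f (\<lambda>i. k i t u)) t u = g (\<lambda>i. k i t u)"
proof -
  have "((\<lambda>u. f (\<lambda>i. k i t u)) has_real_derivative v t u * g (\<lambda>i. k i t u)) (at u)"
    using assms(1)[unfolded total_derivative_def, rule_format, of "\<lambda>i. k i t"] k_deriv[OF \<open>t \<ge> 0\<close>] by simp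
  then have "Du (\<lambda>t u. f (\<lambda>i. k i t u)) t u = v t u * g (\<lambda>i. k i t u)"
    by (intro Du_eqI) (simp add: has_real_derivative_iff_has_vector_derivative)
  then show ?thesis using v_pos[OF \<open>t \<ge> 0\<close>, of u] by (simp add: Ds_eq)
qed

lemma smooth_jet_poly:
  "jet_poly p w f \<Longrightarrow> smooth_family (\<lambda>t u. f (\<lambda>i. k i t u))"
  by (induction rule: jet_poly.induct) (intro smooth_intros; assumption)+

end

lemma jet_poly_curvature_monomials:
  shows "jet_poly 3 (i + j) (\<lambda>a. a 0 * a i * a j)"
    and "jet_poly 5 i (\<lambda>a. a 0 * a 0 * a 0 * a 0 * a i)"
proof -
  have "jet_poly (1 + 1 + 1) (0 + i + j) (\<lambda>a. a 0 * a i * a j)"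
    by (intro jet_poly.intros)
  then show "jet_poly 3 (i + j) (\<lambda>a. a 0 * a i * a j)" by (simp add: eval_nat_numeral)
  have "jet_poly (1 + 1 + 1 + 1 + 1) (0 + 0 + 0 + 0 + i) (\<lambda>a. a 0 * a 0 * a 0 * a 0 * a i)"
    by (intro jet_poly.intros)
  then show "jet_poly 5 i (\<lambda>a. a 0 * a 0 * a 0 * a 0 * a i)" by (simp add: eval_nat_numeral)
qed

text \<open>
  For \<open>l = 0\<close> this is \<open>\<partial>\<^sub>t k = - F\<^sub>s\<^sub>s - k\<^sup>2 F\<close> written out.  Each further derivative differentiates the right-hand
  side and adds the commutator \<open>- k F k\<^sub>l\<^sub>+\<^sub>1\<close>, which again splits into a cubic and a quintic monomial with the
  right number of derivatives.  The polynomials do not depend on the flow, hence neither do the constants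
  derived from them.
\<close>

lemma curvature_deriv_evolution:
  obtains f g where "jet_poly 3 (l + 2) f" "jet_poly 5 l g"
    and "\<And>\<gamma> t u. elastic_flow \<gamma> \<Longrightarrow> t \<ge> 0 \<Longrightarrow> Dt (elastic_flow.k \<gamma> l) t u =
      - elastic_flow.k \<gamma> (l + 4) t u + f (\<lambda>i. elastic_flow.k \<gamma> i t u) + g (\<lambda>i. elastic_flow.k \<gamma> i t u)"
proof -
  have "\<exists>f g. jet_poly 3 (l + 2) f \<and> jet_poly 5 l g \<and>
    (\<forall>\<gamma> t u. elastic_flow \<gamma> \<longrightarrow> t \<ge> 0 \<longrightarrow> Dt (elastic_flow.k \<gamma> l) t u =
      - elastic_flow.k \<gamma> (l + 4) t u + f (\<lambda>i. elastic_flow.k \<gamma> i t u) + g (\<lambda>i. elastic_flow.k \<gamma> i t u))"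
  proof (induction l)
    case 0
    define c where "c = (\<lambda>a::nat \<Rightarrow> real. 1/2 * (a 0 * a 0 * a 0))"
    have c: "jet_poly 3 0 c" unfolding c_def using jet_poly_curvature_monomials(1)[of 0 0] by (intro jet_poly.scale) simp
    obtain c' where c': "jet_poly 3 (Suc 0) c'" "total_derivative c c'"
      using jet_poly_total_derivative[OF c] by blast
    obtain c'' where c'': "jet_poly 3 (Suc (Suc 0)) c''" "total_derivative c' c''"
      using jet_poly_total_derivative[OF c'(1)] by blast
    define f where "f = (\<lambda>a. (-1) * c'' a + (-1) * (a 0 * a 0 * a 2))"
    define g where "g = (\<lambda>a::nat \<Rightarrow> real. (-1/2) * (a 0 * a 0 * a 0 * a 0 * a 0))"
    have "jet_poly 3 (0 + 2) f"
      unfolding f_def using c''(1) jet_poly_curvature_monomials(1)[of 0 2]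
      by (intro jet_poly.add jet_poly.scale) (auto simp: numeral_2_eq_2)
    moreover have "jet_poly 5 0 g"
      unfolding g_def by (intro jet_poly.scale jet_poly_curvature_monomials)
    moreover have "Dt (elastic_flow.k \<gamma> 0) t u =
      - elastic_flow.k \<gamma> (0 + 4) t u + f (\<lambda>i. elastic_flow.k \<gamma> i t u) + g (\<lambda>i. elastic_flow.k \<gamma> i t u)"
      if "elastic_flow \<gamma>" "t \<ge> 0" for \<gamma> t u
    proof -
      interpret elastic_flow \<gamma> by fact
      have DF: "Ds F t u = k 3 t u + c' (\<lambda>i. k i t u)" if "t \<ge> 0" for t u
      proof -
        have "Ds F t u = Ds (\<lambda>t u. k 2 t u + c (\<lambda>i. k i t u)) t u"
          using that by (intro Ds_cong) (simp_all add: F_def c_def power3_eq_cube)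
        also have "\<dots> = Ds (k 2) t u + c' (\<lambda>i. k i t u)"
          by (simp add: Ds_add smooth_intros smooth_jet_poly[OF c] that Ds_jet_poly[OF c'(2)])
        finally show ?thesis by (simp add: numeral_3_eq_3 numeral_2_eq_2 k_Suc)
      qed
      have "Ds (Ds F) t u = Ds (\<lambda>t u. k 3 t u + c' (\<lambda>i. k i t u)) t u"
        using \<open>t \<ge> 0\<close> DF by (intro Ds_cong)
      also have "\<dots> = Ds (k 3) t u + c'' (\<lambda>i. k i t u)"
        by (simp add: Ds_add smooth_intros smooth_jet_poly[OF c'(1)] \<open>t \<ge> 0\<close> Ds_jet_poly[OF c''(2)])
      also have "Ds (k 3) t u = k 4 t u"
        by (simp add: eval_nat_numeral k_Suc)
      finally have DDF: "Ds (Ds F) t u = k 4 t u + c'' (\<lambda>i. k i t u)" .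
      show ?thesis
        unfolding Dt_curvature[OF \<open>t \<ge> 0\<close>] DDF
        by (simp add: f_def g_def F_def power2_eq_square power3_eq_cube algebra_simps)
    qed
    ultimately show ?case by blast
  next
    case (Suc l)
    then obtain f g where f: "jet_poly 3 (l + 2) f" and g: "jet_poly 5 l g" and
      ev: "\<And>\<gamma> t u. elastic_flow \<gamma> \<Longrightarrow> t \<ge> 0 \<Longrightarrow> Dt (elastic_flow.k \<gamma> l) t u =
        - elastic_flow.k \<gamma> (l + 4) t u + f (\<lambda>i. elastic_flow.k \<gamma> i t u) + g (\<lambda>i. elastic_flow.k \<gamma> i t u)"
      by blast
    obtain f' where f': "jet_poly 3 (Suc (l + 2)) f'" "total_derivative f f'"
      using jet_poly_total_derivative[OF f] by blast
    obtain g' where g': "jet_poly 5 (Suc l) g'" "total_derivative g g'"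
      using jet_poly_total_derivative[OF g] by blast
    define f1 where "f1 = (\<lambda>a. f' a + (-1) * (a 0 * a 2 * a (Suc l)))"
    define g1 where "g1 = (\<lambda>a. g' a + (-1/2) * (a 0 * a 0 * a 0 * a 0 * a (Suc l)))"
    have "jet_poly 3 (Suc l + 2) f1"
      unfolding f1_def using f'(1) jet_poly_curvature_monomials(1)[of 2 "Suc l"]
      by (intro jet_poly.add jet_poly.scale) (auto simp: add.commute)
    moreover have "jet_poly 5 (Suc l) g1"
      unfolding g1_def by (intro jet_poly.add g' jet_poly.scale jet_poly_curvature_monomials)
    moreover have "Dt (elastic_flow.k \<gamma> (Suc l)) t u =
        - elastic_flow.k \<gamma> (Suc l + 4) t u + f1 (\<lambda>i. elastic_flow.k \<gamma> i t u) + g1 (\<lambda>i. elastic_flow.k \<gamma> i t u)"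
      if "elastic_flow \<gamma>" "t \<ge> 0" for \<gamma> t u
    proof -
      interpret elastic_flow \<gamma> by fact
      have "Ds (Dt (k l)) t u = Ds (\<lambda>t u. - k (l + 4) t u + (f (\<lambda>i. k i t u) + g (\<lambda>i. k i t u))) t u"
        using \<open>t \<ge> 0\<close> by (intro Ds_cong) (simp_all add: ev[OF elastic_flow_axioms])
      also have "\<dots> = Ds (\<lambda>t u. - k (l + 4) t u) t u + Ds (\<lambda>t u. f (\<lambda>i. k i t u) + g (\<lambda>i. k i t u)) t u"
        by (intro Ds_add smooth_intros smooth_jet_poly[OF f] smooth_jet_poly[OF g] \<open>t \<ge> 0\<close>)
      also have "\<dots> = - Ds (k (l + 4)) t u + (f' (\<lambda>i. k i t u) + g' (\<lambda>i. k i t u))"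
        using \<open>t \<ge> 0\<close>
        by (simp add: Ds_add Ds_minus smooth_intros smooth_jet_poly[OF f] smooth_jet_poly[OF g]
            Ds_jet_poly[OF f'(2)] Ds_jet_poly[OF g'(2)])
      also have "Ds (k (l + 4)) = k (l + 5)" using k_Suc[of "l + 4"] by (simp add: eval_nat_numeral)
      finally show ?thesis
        using \<open>t \<ge> 0\<close>
        by (simp add: k_Suc Dt_Ds smooth_intros f1_def g1_def F_def power3_eq_cube algebra_simps)
    qed
    ultimately show ?case by blast
  qed
  with that show thesis by blast
qed


section \<open>Comparison on the half-line\<close>

lemma nonincreasing_if_deriv_nonpos:
  fixes f f' :: "real \<Rightarrow> real"
  assumes deriv: "\<And>t. t \<ge> 0 \<Longrightarrow> (f has_real_derivative f' t) (at t within {0..})"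
    and "0 \<le> a" "a \<le> b" and nonpos: "\<And>t. a < t \<Longrightarrow> t < b \<Longrightarrow> f' t \<le> 0"
  shows "f b \<le> f a"
proof (rule DERIV_nonpos_imp_decreasing_open[OF \<open>a \<le> b\<close>])
  fix t assume t: "a < t" "t < b"
  then have "at t within {0..} = at t" using \<open>0 \<le> a\<close> by (intro at_within_interior) auto
  with deriv[of t] nonpos[OF t] t \<open>0 \<le> a\<close> show "\<exists>y. (f has_real_derivative y) (at t) \<and> y \<le> 0" by auto
next
  have "continuous_on {0..} f"
    using deriv by (auto intro: DERIV_continuous simp: continuous_on_eq_continuous_within)
  then show "continuous_on {a..b} f" by (rule continuous_on_subset) (use \<open>0 \<le> a\<close> in auto)
qed

text \<open>
  Starting from the last time at which \<open>Q\<close> was at most \<open>M\<close>, the function could only have decreased.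
\<close>

lemma le_if_decreasing_above:
  fixes Q Q' :: "real \<Rightarrow> real"
  assumes deriv: "\<And>t. t \<ge> 0 \<Longrightarrow> (Q has_real_derivative Q' t) (at t within {0..})"
    and start: "Q 0 \<le> M" and above: "\<And>t. t \<ge> 0 \<Longrightarrow> Q t > M \<Longrightarrow> Q' t \<le> 0" and "t \<ge> 0"
  shows "Q t \<le> M"
proof (rule ccontr)
  assume "\<not> Q t \<le> M"
  have cont: "continuous_on {0..} Q"
    using deriv by (auto intro: DERIV_continuous simp: continuous_on_eq_continuous_within)
  define S where "S = {s \<in> {0..t}. Q s \<le> M}"
  have "closed ({0..t} \<inter> Q -` {..M})"
    by (intro continuous_closed_preimage continuous_on_subset[OF cont]) auto
  also have "{0..t} \<inter> Q -` {..M} = S" by (auto simp: S_def)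
  finally have "closed S" .
  have S: "S \<noteq> {}" "bdd_above S" unfolding S_def using start \<open>t \<ge> 0\<close> by (auto intro!: bdd_aboveI[of _ t])
  define a where "a = Sup S"
  have a: "a \<in> S" unfolding a_def by (rule closed_contains_Sup[OF S \<open>closed S\<close>])
  have "Q t \<le> Q a"
  proof (rule nonincreasing_if_deriv_nonpos[OF deriv])
    fix s assume s: "a < s" "s < t"
    then have "s \<notin> S" using cSup_upper[OF _ S(2)] by (force simp: a_def)
    then show "Q' s \<le> 0" using s a by (intro above) (auto simp: S_def)
  qed (use a in \<open>auto simp: S_def\<close>)
  with a \<open>\<not> Q t \<le> M\<close> show False by (simp add: S_def)
qed

section \<open>Rescaling to unit length\<close>

context elastic_flow
begin

definition L :: "real \<Rightarrow> real" where "L t = curve_length (\<gamma> t)"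

definition b :: "real \<Rightarrow> nat \<Rightarrow> real \<Rightarrow> real" where "b t i u = L t ^ Suc i * k i t u"

definition \<sigma> :: "real \<Rightarrow> real \<Rightarrow> real" where "\<sigma> t u = v t u / L t"

definition Q :: "nat \<Rightarrow> real \<Rightarrow> real" where
  "Q l t = L t ^ (2 * l + 1) * L2_norm_sq (\<gamma> t) (curvature_deriv (\<gamma> t) l)"

lemma L_eq: "L t = integral {0..1} (v t)"
  by (simp add: L_def curve_length_def arc_integral_def v_def)

lemma L2_eq: "L2_norm_sq (\<gamma> t) (curvature_deriv (\<gamma> t) l) = integral {0..1} (\<lambda>u. (k l t u)\<^sup>2 * v t u)"
  by (simp add: L2_norm_sq_def arc_integral_def v_def k_def)

lemma L_pos:
  assumes "t \<ge> 0" shows "L t > 0"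
proof -
  have int: "v t integrable_on {0..1}"
    by (intro integrable_continuous_real smooth_continuous_space smooth_v assms)
  have "L t \<noteq> 0"
  proof
    assume "L t = 0"
    then have "\<forall>u\<in>cbox 0 1. v t u = 0"
      using v_pos[OF assms] integral_eq_0_iff[of 0 1 "v t"]
      by (simp add: L_eq smooth_continuous_space[OF smooth_v assms] less_imp_le)
    then show False using v_pos[OF assms, of 0] by simp
  qed
  moreover have "L t \<ge> 0"
    unfolding L_eq using v_pos[OF assms] by (intro integral_nonneg int) (simp add: less_imp_le)
  ultimately show ?thesis by simp
qed

lemma unit_jet_b:
  assumes t: "t \<ge> 0" shows "unit_jet (b t) (\<sigma> t)"
proof
  show "(b t i has_real_derivative \<sigma> t u * b t (Suc i) u) (at u)" for i u
  proof -
    have "((\<lambda>u. L t ^ Suc i * k i t u) has_real_derivative L t ^ Suc i * (v t u * k (Suc i) t u)) (at u)"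
      by (intro DERIV_cmult k_deriv t)
    moreover have "b t i = (\<lambda>u. L t ^ Suc i * k i t u)" by (simp add: fun_eq_iff b_def)
    moreover have "\<sigma> t u * b t (Suc i) u = L t ^ Suc i * (v t u * k (Suc i) t u)"
      using L_pos[OF t] by (simp add: \<sigma>_def b_def)
    ultimately show ?thesis by simp
  qed
  show "continuous_on UNIV (\<sigma> t)"
    unfolding \<sigma>_def using L_pos[OF t]
    by (intro continuous_intros smooth_continuous_space smooth_v t) auto
  show "0 < \<sigma> t u" for u using L_pos[OF t] v_pos[OF t] by (simp add: \<sigma>_def)
  show "b t i 1 = b t i 0" for i using k_periodic[OF t, of i 0] by (simp add: b_def)
  show "integral {0..1} (\<sigma> t) = 1"
    unfolding \<sigma>_def using L_pos[OF t] by (simp add: L_eq[symmetric])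
qed

abbreviation Jt :: "real \<Rightarrow> (real \<Rightarrow> real) \<Rightarrow> real" where "Jt t \<equiv> unit_jet.J (\<sigma> t)"

lemma J_scaled:
  assumes t: "t \<ge> 0" and f: "\<And>u. f u = L t ^ Suc w * g u"
  shows "Jt t f = L t ^ w * integral {0..1} (\<lambda>u. g u * v t u)"
proof -
  have "(\<lambda>u. f u * \<sigma> t u) = (\<lambda>u. L t ^ w * (g u * v t u))"
    using L_pos[OF t] by (auto simp: f \<sigma>_def)
  then show ?thesis by (simp add: unit_jet.J_def[OF unit_jet_b[OF t]])
qed

lemma jet_poly_rescaled:
  assumes "jet_poly p w f" and t: "t \<ge> 0"
  shows "f (\<lambda>i. b t i u) = L t ^ (p + w) * f (\<lambda>i. k i t u)"
  using jet_poly_homogeneous[OF assms(1)] by (simp add: b_def)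

lemma J_square: "t \<ge> 0 \<Longrightarrow> Jt t (\<lambda>u. (b t l u)\<^sup>2) = Q l t"
  unfolding Q_def L2_eq
  by (rule J_scaled) (auto simp: b_def power2_eq_square power_add mult_2)

lemma scaled_energy_eq: "t \<ge> 0 \<Longrightarrow> Jt t (\<lambda>u. (b t 1 u)\<^sup>2) = scaled_energy (\<gamma> t)"
  unfolding J_square by (simp add: Q_def scaled_energy_def L_def eval_nat_numeral)

section \<open>Turning number\<close>

lemma F_periodic: "t \<ge> 0 \<Longrightarrow> F t (u + 1) = F t u"
  by (simp add: F_def k_periodic)

text \<open>
  The integrand \<open>k v\<close> has the time derivative \<open>- (F\<^sub>s\<^sub>s + k\<^sup>2 F) v + k \<cdot> k F v = - \<partial>\<^sub>u F\<^sub>s\<close>, which integrates to zero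
  over a period.
\<close>

lemma total_curvature_constant:
  assumes "t \<ge> 0"
  shows "integral {0..1} (\<lambda>u. k 0 t u * v t u) = integral {0..1} (\<lambda>u. k 0 0 u * v 0 u)"
proof -
  have "((\<lambda>t. integral {0..1} (\<lambda>u. k 0 t u * v t u)) has_real_derivative 0) (at t within {0..})"
    if t: "t \<in> {0..}" for t
  proof -
    have "Dt (\<lambda>t u. k 0 t u * v t u) t = (\<lambda>u. - Du (Ds F) t u)"
      using t by (intro ext) (simp add: Dt_mult smooth_intros Dt_v Dt_curvature Du_eq algebra_simps power2_eq_square)
    moreover have "(Du (Ds F) t has_integral (Ds F t 1 - Ds F t 0)) {0..1}"
      using t by (intro fundamental_theorem_of_calculus 
        has_vector_derivative_at_within[OF has_Du[OF smooth_Ds[OF smooth_F]]]) auto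
    moreover have "Ds F t 1 = Ds F t 0"
      using Ds_periodic[OF smooth_F F_periodic, of t 0] t by simp
    ultimately have zero: "integral {0..1} (Dt (\<lambda>t u. k 0 t u * v t u) t) = 0"
      by (simp add: integral_unique)
    have "smooth_family (\<lambda>t u. k 0 t u * v t u)" by (intro smooth_intros)
    from integral_has_Dt[OF this, of t] t zero show ?thesis by simp
  qed
  from has_field_derivative_zero_constant[OF _ this]
  obtain c where "\<forall>t\<in>{0..}. integral {0..1} (\<lambda>u. k 0 t u * v t u) = c" by auto
  with assms show ?thesis by simp
qed

lemma mean_curvature:
  assumes "t \<ge> 0"
  shows "\<bar>Jt t (b t 0)\<bar> = 2 * pi * flow_turning_number \<gamma>"
proof -
  have "Jt t (b t 0) = integral {0..1} (\<lambda>u. k 0 t u * v t u)"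
    using J_scaled[OF assms, of "b t 0" 0 "k 0 t"] by (simp add: b_def)
  also have "\<dots> = arc_integral (\<gamma> 0) (curvature (\<gamma> 0))"
    unfolding total_curvature_constant[OF assms]
    by (simp add: arc_integral_def k_def curvature_deriv_def v_def)
  finally show ?thesis
    by (simp add: flow_turning_number_def abs_turning_number_def abs_mult)
qed

section \<open>Length\<close>

lemma L_deriv:
  assumes "t \<ge> 0"
  shows "(L has_real_derivative integral {0..1} (\<lambda>u. k 0 t u * F t u * v t u)) (at t within {0..})"
proof -
  have "Dt v t = (\<lambda>u. k 0 t u * F t u * v t u)" using Dt_v[OF assms] by auto
  moreover have "L = (\<lambda>t. integral {0..1} (v t))" by (simp add: fun_eq_iff L_eq)
  ultimately show ?thesis using integral_has_Dt[OF smooth_v assms] by simp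
qed

text \<open>
  After rescaling \<open>k F\<close> becomes \<open>b 0 * b 2 + (b 0)\<^sup>4 / 2\<close>, and the first product integrates to
  \<open>- \<integral> (b 1)\<^sup>2\<close>.
\<close>

lemma L_deriv_scaled:
  assumes t: "t \<ge> 0"
  shows "L t ^ 3 * integral {0..1} (\<lambda>u. k 0 t u * F t u * v t u)
    = 1/2 * Jt t (\<lambda>u. b t 0 u ^ 4) - scaled_energy (\<gamma> t)"
proof -
  interpret unit_jet "b t" "\<sigma> t" by (rule unit_jet_b[OF t])
  have "L t ^ 3 * integral {0..1} (\<lambda>u. k 0 t u * F t u * v t u) = J (\<lambda>u. b t 0 u * b t 2 u + 1/2 * b t 0 u ^ 4)"
    by (rule J_scaled[OF t, symmetric])
      (simp add: b_def F_def power2_eq_square power3_eq_cube power4_eq_xxxx algebra_simps eval_nat_numeral)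
  also have "\<dots> = J (\<lambda>u. b t 0 u * b t 2 u) + 1/2 * J (\<lambda>u. b t 0 u ^ 4)"
    by (subst J_add J_cmult; (intro continuous_intros)?)+ simp
  also have "J (\<lambda>u. b t 0 u * b t 2 u) = - J (\<lambda>u. (b t 1 u)\<^sup>2)"
    using integration_by_parts[of 0 1] by (simp add: power2_eq_square numeral_2_eq_2)
  finally show ?thesis unfolding scaled_energy_eq[OF t] by simp
qed

text \<open>
  Jensen's inequality gives \<open>\<integral> (b 0)\<^sup>4 \<ge> (2 \<pi> \<omega>)\<^sup>4\<close>, so that \<open>L\<^sup>3 L' \<ge> 8 \<omega>\<^sup>4 \<pi>\<^sup>4 - \<omega>\<^sup>4 \<pi>\<^sup>4\<close>.  This makes the derivative of
  \<open>L\<^sup>4\<close> at least \<open>28 \<omega>\<^sup>4 \<pi>\<^sup>4\<close>, far more than the rate 1 that is recorded.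
\<close>

lemma L_growth:
  assumes turning: "flow_turning_number \<gamma> \<ge> 1" and small: "\<And>t. t \<ge> 0 \<Longrightarrow> scaled_energy (\<gamma> t) \<le> (flow_turning_number \<gamma>) ^ 4 * pi ^ 4"
    and "t \<ge> 0"
  shows "L t ^ 4 \<ge> L 0 ^ 4 + t"
proof -
  let ?\<omega> = "flow_turning_number \<gamma>"
  have "t - L t ^ 4 \<le> 0 - L 0 ^ 4"
  proof (rule nonincreasing_if_deriv_nonpos[where f = "\<lambda>t. t - L t ^ 4" and a = 0 and b = t])
    fix s :: real assume s: "s \<ge> 0"
    show "((\<lambda>t. t - L t ^ 4) has_real_derivative
        1 - 4 * (L s ^ 3 * integral {0..1} (\<lambda>u. k 0 s u * F s u * v s u))) (at s within {0..})"
      by (rule derivative_eq_intros L_deriv[OF s] refl)+ simp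
  next
    fix s assume s: "0 < s" "s < t"
    then interpret unit_jet "b s" "\<sigma> s" by (intro unit_jet_b) auto
    have "(J (\<lambda>u. b s 0 u))\<^sup>2 \<le> J (\<lambda>u. (b s 0 u)\<^sup>2)"
      using J_Cauchy_Schwarz[of "b s 0" "\<lambda>_. 1"] by (simp add: continuous_intros J_const)
    then have "((J (\<lambda>u. b s 0 u))\<^sup>2)\<^sup>2 \<le> (J (\<lambda>u. (b s 0 u)\<^sup>2))\<^sup>2"
      by (intro power_mono) auto
    also have "\<dots> \<le> J (\<lambda>u. b s 0 u ^ 4)"
      using J_Cauchy_Schwarz[of "\<lambda>u. (b s 0 u)\<^sup>2" "\<lambda>_. 1"] by (simp add: continuous_intros J_const)
    also have "((J (\<lambda>u. b s 0 u))\<^sup>2)\<^sup>2 = \<bar>J (b s 0)\<bar> ^ 4" by simp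
    also have "\<dots> = 16 * (?\<omega> ^ 4 * pi ^ 4)"
      using mean_curvature[of s] s by (simp add: power_mult_distrib)
    finally have "L s ^ 3 * integral {0..1} (\<lambda>u. k 0 s u * F s u * v s u) \<ge> 7 * (?\<omega> ^ 4 * pi ^ 4)"
      using L_deriv_scaled[of s] small[of s] s by simp
    moreover have "?\<omega> ^ 4 * pi ^ 4 \<ge> 1"
    proof -
      have "pi ^ 4 \<ge> 1" using pi_ge_two by (intro one_le_power) simp
      then show ?thesis
        using one_le_power[OF turning, of 4] mult_mono[of 1 "?\<omega> ^ 4" 1 "pi ^ 4"] by simp
    qed
    ultimately show "1 - 4 * (L s ^ 3 * integral {0..1} (\<lambda>u. k 0 s u * F s u * v s u)) \<le> 0" by linarith
  qed (use \<open>t \<ge> 0\<close> in auto)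
  then show ?thesis by simp
qed

section \<open>Scale-invariant energies\<close>

lemma energy_deriv:
  assumes t: "t \<ge> 0"
  shows "((\<lambda>t. L2_norm_sq (\<gamma> t) (curvature_deriv (\<gamma> t) l)) has_real_derivative
    integral {0..1} (\<lambda>u. (2 * k l t u * Dt (k l) t u + (k l t u)\<^sup>2 * (k 0 t u * F t u)) * v t u)) (at t within {0..})"
proof -
  have "smooth_family (\<lambda>t u. (k l t u * k l t u) * v t u)" by (intro smooth_intros)
  from integral_has_Dt[OF this t]
  have "((\<lambda>t. integral {0..1} (\<lambda>u. k l t u * k l t u * v t u)) has_real_derivative
      integral {0..1} (\<lambda>u. Dt (\<lambda>t u. k l t u * k l t u * v t u) t u)) (at t within {0..})" .
  moreover have "Dt (\<lambda>t u. (k l t u * k l t u) * v t u) t u =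
      (2 * k l t u * Dt (k l) t u + (k l t u)\<^sup>2 * (k 0 t u * F t u)) * v t u" for u
    by (simp add: Dt_mult smooth_intros t Dt_v power2_eq_square algebra_simps)
  ultimately show ?thesis
    unfolding L2_eq by (simp add: power2_eq_square)
qed

end

text \<open>
  Differentiating \<open>Q l = L\<^sup>2\<^sup>l\<^sup>+\<^sup>1 \<integral> k\<^sub>l\<^sup>2 ds\<close> gives a multiple of \<open>L' / L\<close> times \<open>Q l\<close> and the derivative of the
  integral.  Multiplication by \<open>L\<^sup>4\<close> makes both terms scale-invariant: \<open>L\<^sup>3 L'\<close> is bounded above because the
  rescaled curvature is, and the sum is then dominated by the left-hand side of the energy inequality on
  the curve of unit length.
\<close>

lemma scaled_energy_bound:
  assumes "l \<ge> 1" "\<epsilon> > 0" "\<omega> \<ge> 0"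
  obtains C where "\<And>\<gamma> t. elastic_flow \<gamma> \<Longrightarrow> flow_turning_number \<gamma> = \<omega> \<Longrightarrow>
      (\<And>t. t \<ge> 0 \<Longrightarrow> scaled_energy (\<gamma> t) \<le> \<epsilon>) \<Longrightarrow> t \<ge> 0 \<Longrightarrow>
      elastic_flow.Q \<gamma> l t \<le> max (elastic_flow.Q \<gamma> l 0) C"
proof -
  obtain f g where f: "jet_poly 3 (l + 2) f" and g: "jet_poly 5 l g" and
    ev: "\<And>\<gamma> t u. elastic_flow \<gamma> \<Longrightarrow> t \<ge> 0 \<Longrightarrow> Dt (elastic_flow.k \<gamma> l) t u =
      - elastic_flow.k \<gamma> (l + 4) t u + f (\<lambda>i. elastic_flow.k \<gamma> i t u) + g (\<lambda>i. elastic_flow.k \<gamma> i t u)"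
    using curvature_deriv_evolution by blast
  \<comment> \<open>The arc length element contributes \<open>k\<^sub>l\<^sup>2 k F = k\<^sub>l (k k\<^sub>2 k\<^sub>l + k\<^sup>4 k\<^sub>l / 2)\<close> to the derivative of \<open>\<integral> k\<^sub>l\<^sup>2 ds\<close>;
    its two summands have the same type as \<open>f\<close> and \<open>g\<close>.\<close>
  define f1 where "f1 = (\<lambda>a. 2 * f a + a 0 * a 2 * a l)"
  define g1 where "g1 = (\<lambda>a. 2 * g a + 1/2 * (a 0 * a 0 * a 0 * a 0 * a l))"
  have f1: "jet_poly 3 (l + 2) f1"
    unfolding f1_def using jet_poly_curvature_monomials(1)[of 2 l]
    by (intro jet_poly.add jet_poly.scale f) (simp add: add.commute)
  have g1: "jet_poly 5 l g1"
    unfolding g1_def by (intro jet_poly.add jet_poly.scale g jet_poly_curvature_monomials)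
  define W A where "W = 2 * pi * \<omega>" and "A = sqrt \<epsilon>"
  have WA: "W \<ge> 0" "A > 0" "A\<^sup>2 = \<epsilon>" using assms by (simp_all add: W_def A_def)
  define c where "c = (2 * l + 1) * (1/2 * (W + A) ^ 4)"
  have "c \<ge> 0" using WA by (simp add: c_def)
  obtain C where C: "\<And>b \<sigma>. unit_jet b \<sigma> \<Longrightarrow> \<bar>unit_jet.J \<sigma> (b 0)\<bar> \<le> W \<Longrightarrow>
      unit_jet.J \<sigma> (\<lambda>u. (b 1 u)\<^sup>2) \<le> A\<^sup>2 \<Longrightarrow>
      c * unit_jet.J \<sigma> (\<lambda>u. (b l u)\<^sup>2) - 2 * unit_jet.J \<sigma> (\<lambda>u. b l u * b (l + 4) u)
        + unit_jet.J \<sigma> (\<lambda>u. b l u * (f1 (\<lambda>i. b i u) + g1 (\<lambda>i. b i u)))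
      \<le> C - unit_jet.J \<sigma> (\<lambda>u. (b l u)\<^sup>2)"
    by (rule unit_jet_energy_inequality[OF f1 g1 \<open>l \<ge> 1\<close> \<open>A > 0\<close> \<open>W \<ge> 0\<close> \<open>c \<ge> 0\<close>]) blast
  show thesis
  proof (rule that)
    fix \<gamma> and T :: real
    assume "elastic_flow \<gamma>" and turning: "flow_turning_number \<gamma> = \<omega>"
      and small: "\<And>t. t \<ge> 0 \<Longrightarrow> scaled_energy (\<gamma> t) \<le> \<epsilon>" and "T \<ge> 0"
    interpret elastic_flow \<gamma> by fact
    define L' where "L' t = integral {0..1} (\<lambda>u. k 0 t u * F t u * v t u)" for t
    define E where "E t = L2_norm_sq (\<gamma> t) (curvature_deriv (\<gamma> t) l)" for t
    define E' where "E' t = integral {0..1} (\<lambda>u. (2 * k l t u * Dt (k l) t u + (k l t u)\<^sup>2 * (k 0 t u * F t u)) * v t u)" for t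
    define Q' where "Q' t = (2 * l + 1) * L t ^ (2 * l) * L' t * E t + L t ^ (2 * l + 1) * E' t" for t
    show "Q l T \<le> max (Q l 0) C"
    proof (rule le_if_decreasing_above[where Q = "Q l" and Q' = Q'])
      fix t :: real assume t: "t \<ge> 0"
      have "((\<lambda>t. L t ^ (2 * l + 1) * E t) has_real_derivative Q' t) (at t within {0..})"
        unfolding Q'_def L'_def E'_def E_def
        by (rule derivative_eq_intros L_deriv[OF t] energy_deriv[OF t] refl)+ simp
      moreover have "Q l = (\<lambda>t. L t ^ (2 * l + 1) * E t)" by (simp add: fun_eq_iff Q_def E_def)
      ultimately show "(Q l has_real_derivative Q' t) (at t within {0..})" by simp
    next
      fix t :: real assume t: "t \<ge> 0" and large: "max (Q l 0) C < Q l t"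
      interpret unit_jet "b t" "\<sigma> t" by (rule unit_jet_b[OF t])
      have mean: "\<bar>J (b t 0)\<bar> \<le> W" using mean_curvature[OF t] turning by (simp add: W_def)
      have grad: "J (\<lambda>u. (b t 1 u)\<^sup>2) \<le> A\<^sup>2" using small[OF t] WA unfolding scaled_energy_eq[OF t] by simp
      have "n 1 \<le> A" unfolding n_def using grad WA by (intro real_le_lsqrt) auto
      then have sup: "\<bar>b t 0 u\<bar> \<le> W + A" if "u \<in> {0..1}" for u
        using sup_le[OF that, of 0] mean by simp
      have "b t 0 u ^ 4 \<le> (W + A) ^ 4" if "u \<in> {0..1}" for u
        using power_mono[OF sup[OF that], of 4] by simp
      then have "J (\<lambda>u. b t 0 u ^ 4) \<le> J (\<lambda>_. (W + A) ^ 4)"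
        by (intro J_mono continuous_intros)
      then have L'_le: "L t ^ 3 * L' t \<le> 1/2 * (W + A) ^ 4"
        using L_deriv_scaled[OF t] J_nonneg[of "\<lambda>u. (b t 1 u)\<^sup>2"]
        unfolding L'_def J_const scaled_energy_eq[OF t] by (simp add: continuous_intros)
      have "L t ^ (2 * l + 5) * E' t = J (\<lambda>u. (-2) * (b t l u * b t (l + 4) u) + b t l u * (f1 (\<lambda>i. b t i u) + g1 (\<lambda>i. b t i u)))"
        unfolding E'_def
      proof (rule J_scaled[OF t, symmetric])
        fix u
        have e: "3 + (l + 2) = l + 5" "5 + l = l + 5" "Suc (2 * l + 5) = Suc l + (l + 5)" by simp_all
        have "b t l u * b t (l + 4) u = L t ^ Suc (2 * l + 5) * (k l t u * k (l + 4) t u)"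
          unfolding e by (simp add: b_def power_add eval_nat_numeral)
        moreover have "b t l u * (f1 (\<lambda>i. b t i u) + g1 (\<lambda>i. b t i u)) =
            L t ^ Suc (2 * l + 5) * (k l t u * (f1 (\<lambda>i. k i t u) + g1 (\<lambda>i. k i t u)))"
          unfolding jet_poly_rescaled[OF f1 t] jet_poly_rescaled[OF g1 t] e by (simp only: b_def power_add distrib_left mult_ac)
        moreover have "2 * k l t u * Dt (k l) t u + (k l t u)\<^sup>2 * (k 0 t u * F t u) =
            (-2) * (k l t u * k (l + 4) t u) + k l t u * (f1 (\<lambda>i. k i t u) + g1 (\<lambda>i. k i t u))"
          unfolding ev[OF elastic_flow_axioms t] f1_def g1_def F_def
          by (simp add: power2_eq_square power3_eq_cube algebra_simps)
        ultimately show "(-2) * (b t l u * b t (l + 4) u) + b t l u * (f1 (\<lambda>i. b t i u) + g1 (\<lambda>i. b t i u)) =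
            L t ^ Suc (2 * l + 5) * (2 * k l t u * Dt (k l) t u + (k l t u)\<^sup>2 * (k 0 t u * F t u))"
          by (simp only: distrib_left mult.left_commute)
      qed
      also have "\<dots> = (-2) * J (\<lambda>u. b t l u * b t (l + 4) u) + J (\<lambda>u. b t l u * (f1 (\<lambda>i. b t i u) + g1 (\<lambda>i. b t i u)))"
        by (subst J_add J_cmult; (intro continuous_intros continuous_on_jet_poly[OF f1] continuous_on_jet_poly[OF g1])?)+ simp
      finally have E'_eq: "L t ^ (2 * l + 5) * E' t =
        (-2) * J (\<lambda>u. b t l u * b t (l + 4) u) + J (\<lambda>u. b t l u * (f1 (\<lambda>i. b t i u) + g1 (\<lambda>i. b t i u)))" .
      have Q_nonneg: "Q l t \<ge> 0"
        unfolding J_square[OF t, symmetric] by (intro J_nonneg continuous_intros) auto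
      have "L t ^ 4 * Q' t = (2 * l + 1) * (L t ^ 3 * L' t) * Q l t + L t ^ (2 * l + 5) * E' t"
        by (simp add: Q'_def Q_def E_def power_add algebra_simps eval_nat_numeral)
      also have "\<dots> \<le> c * Q l t + L t ^ (2 * l + 5) * E' t"
        unfolding c_def using L'_le Q_nonneg
        by (intro add_right_mono mult_right_mono mult_left_mono) auto
      also have "\<dots> \<le> C - Q l t"
        using C[OF unit_jet_axioms mean grad] unfolding E'_eq J_square[OF t] by simp
      also have "\<dots> \<le> 0" using large by simp
      finally show "Q' t \<le> 0"
        using L_pos[OF t] by (simp add: mult_le_0_iff)
    qed (use \<open>T \<ge> 0\<close> in auto)
  qed
qed

section \<open>Decay of the derivatives of curvature\<close>

context elastic_flow
begin

lemma curvature_deriv_sup_bound: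
  assumes t: "t \<ge> 0" and "m \<ge> 1"
  shows "L t ^ (4 * (m + 1)) * \<bar>k m t u\<bar> ^ 4 \<le> scaled_energy (\<gamma> t) * Q (2 * m + 1) t"
proof -
  interpret unit_jet "b t" "\<sigma> t" by (rule unit_jet_b[OF t])
  interpret k: periodic_fun_simple' "k m t" by standard (rule k_periodic[OF t])
  have "k m t u = k m t (frac u)"
    using k.minus_of_int[of u "\<lfloor>u\<rfloor>"] by (simp add: frac_def)
  moreover have "frac u \<in> {0..1}" by (simp add: frac_ge_0 less_imp_le[OF frac_lt_1])
  from sup_le_interpolated[OF this \<open>m \<ge> 1\<close>]
  have "\<bar>b t m (frac u)\<bar> ^ 4 \<le> scaled_energy (\<gamma> t) * Q (2 * m + 1) t"
    unfolding J_square[OF t] scaled_energy_eq[OF t, unfolded J_square[OF t], symmetric] .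
  moreover have "\<bar>b t m (frac u)\<bar> ^ 4 = L t ^ (4 * (m + 1)) * \<bar>k m t (frac u)\<bar> ^ 4"
  proof -
    have "\<bar>b t m (frac u)\<bar> ^ 4 = (L t ^ (m + 1)) ^ 4 * \<bar>k m t (frac u)\<bar> ^ 4"
      using L_pos[OF t] by (simp add: b_def abs_mult power_mult_distrib)
    also have "(L t ^ (m + 1)) ^ 4 = L t ^ (4 * (m + 1))"
      unfolding power_mult[symmetric] by (simp add: mult.commute)
    finally show ?thesis .
  qed
  ultimately show ?thesis by simp
qed

end

theorem lemma3p13:
  fixes \<omega> m :: nat and c1 c3 \<epsilon>1 \<epsilon>2 :: real
  assumes "\<omega> \<ge> 1"
    and "c1 > 0" and "c3 > 0" and "0 < \<epsilon>2" and "\<epsilon>2 < \<epsilon>1"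
    and "\<epsilon>1 * C_hat \<epsilon>1 \<omega> \<le> 16 * real \<omega> ^ 4 * pi ^ 4"
    and "\<And>\<gamma> t. free_elastic_flow \<gamma> \<Longrightarrow> flow_turning_number \<gamma> = real \<omega> \<Longrightarrow>
           scaled_energy (\<gamma> 0) \<le> \<epsilon>2 \<Longrightarrow> t \<ge> 0 \<Longrightarrow>
           scaled_energy (\<gamma> t) \<le> \<epsilon>1 \<and>
           scaled_energy (\<gamma> t) \<le> c3 * (1 + t / curve_length (\<gamma> 0) ^ 4) powr (- c1)"
    and "m \<ge> 1"
  shows "\<exists>C :: real \<Rightarrow> real \<Rightarrow> real. \<forall>\<gamma>.
           free_elastic_flow \<gamma> \<and> flow_turning_number \<gamma> = real \<omega> \<and> scaled_energy (\<gamma> 0) < \<epsilon>2 \<longrightarrow>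
           (\<forall>t\<ge>0. sup_norm (curvature_deriv (\<gamma> t) m)
              \<le> C (curve_length (\<gamma> 0)) (L2_norm_sq (\<gamma> 0) (curvature_deriv (\<gamma> 0) (2 * m + 1)))
                 * (1 + t) powr (- (real m + 1 + c1) / 4))"
proof -
  define l where "l = 2 * m + 1"
  have "\<epsilon>1 > 0" using assms by simp
  \<comment> \<open>The two leading summands of \<open>C_hat\<close> already add up to at least \<open>16\<close>.\<close>
  have \<epsilon>1_le: "\<epsilon>1 \<le> real \<omega> ^ 4 * pi ^ 4"
  proof -
    have "(real \<omega>)\<^sup>2 \<ge> 1" using \<open>\<omega> \<ge> 1\<close> by (intro one_le_power) simp
    moreover have "sqrt (8 * (real \<omega>)\<^sup>2 / pi ^ 3) * sqrt \<epsilon>1 \<ge> 0" "1 / (4 * pi ^ 3) * \<epsilon>1 \<ge> 0"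
      using \<open>\<epsilon>1 > 0\<close> by simp_all
    ultimately have "C_hat \<epsilon>1 \<omega> \<ge> 16" unfolding C_hat_def by linarith
    then have "\<epsilon>1 * 16 \<le> \<epsilon>1 * C_hat \<epsilon>1 \<omega>" using \<open>\<epsilon>1 > 0\<close> by simp
    with assms(6) show ?thesis by simp
  qed
  obtain K where K: "\<And>\<gamma> t. elastic_flow \<gamma> \<Longrightarrow> flow_turning_number \<gamma> = real \<omega> \<Longrightarrow>
      (\<And>t. t \<ge> 0 \<Longrightarrow> scaled_energy (\<gamma> t) \<le> \<epsilon>1) \<Longrightarrow> t \<ge> 0 \<Longrightarrow>
      elastic_flow.Q \<gamma> l t \<le> max (elastic_flow.Q \<gamma> l 0) K"
    using scaled_energy_bound[of l \<epsilon>1 "real \<omega>"] \<open>\<epsilon>1 > 0\<close> by (auto simp: l_def)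
  \<comment> \<open>\<open>q\<close> and \<open>p\<close> trade the time scale \<open>L0\<^sup>4\<close> of the flow for the scale 1 of the statement:
    \<open>q (1 + t) \<le> L0\<^sup>4 + t\<close> and \<open>p (1 + t) \<le> 1 + t / L0\<^sup>4\<close>.\<close>
  define q where "q L0 = min 1 (L0 ^ 4)" for L0 :: real
  define p where "p L0 = min 1 (1 / L0 ^ 4)" for L0 :: real
  define M where "M L0 E0 = max (L0 ^ (2 * l + 1) * E0) K" for L0 E0
  define R where "R L0 E0 = c3 * p L0 powr (- c1) * M L0 E0 / q L0 ^ (m + 1)" for L0 E0
  define C where "C L0 E0 = R L0 E0 powr (1/4)" for L0 E0
  show ?thesis
  proof (intro exI[of _ C] allI impI; elim conjE)
    fix \<gamma> and t :: real
    assume "free_elastic_flow \<gamma>" and turning: "flow_turning_number \<gamma> = real \<omega>"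
      and "scaled_energy (\<gamma> 0) < \<epsilon>2" and t: "t \<ge> 0"
    then interpret elastic_flow \<gamma> by unfold_locales
    note flow_bounds = assms(7)[OF flow turning less_imp_le[OF \<open>scaled_energy (\<gamma> 0) < \<epsilon>2\<close>]]
    define L0 where "L0 = L 0"
    define E0 where "E0 = L2_norm_sq (\<gamma> 0) (curvature_deriv (\<gamma> 0) l)"
    have "L0 > 0" using L_pos[of 0] by (simp add: L0_def)
    then have "q L0 > 0" "p L0 > 0" by (simp_all add: q_def p_def)
    have energy: "scaled_energy (\<gamma> t) \<le> c3 * p L0 powr (- c1) * (1 + t) powr (- c1)"
    proof -
      have "p L0 * (1 + t) \<le> 1 + t / L0 ^ 4"
      proof -
        have "p L0 \<le> 1" "p L0 * t \<le> 1 / L0 ^ 4 * t"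
          using t by (simp_all add: p_def mult_right_mono del: times_divide_eq_left)
        then show ?thesis by (simp add: distrib_left)
      qed
      then have "(1 + t / L0 ^ 4) powr (- c1) \<le> (p L0 * (1 + t)) powr (- c1)"
        using \<open>p L0 > 0\<close> t \<open>c1 > 0\<close> by (intro powr_mono2') auto
      also have "\<dots> = p L0 powr (- c1) * (1 + t) powr (- c1)"
        using \<open>p L0 > 0\<close> t by (simp add: powr_mult)
      finally have "c3 * (1 + t / L0 ^ 4) powr (- c1) \<le> c3 * (p L0 powr (- c1) * (1 + t) powr (- c1))"
        using \<open>c3 > 0\<close> by (intro mult_left_mono) auto
      then show ?thesis
        using flow_bounds[OF t] by (simp add: L0_def L_def mult.assoc)
    qed
    have Q_le: "Q l t \<le> M L0 E0"
      using K[OF elastic_flow_axioms turning _ t] flow_bounds by (simp add: M_def L0_def E0_def Q_def)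
    have Q_nonneg: "Q l t \<ge> 0"
    proof -
      interpret unit_jet "b t" "\<sigma> t" by (rule unit_jet_b[OF t])
      show ?thesis unfolding J_square[OF t, symmetric] by (intro J_nonneg continuous_intros) auto
    qed
    have growth: "q L0 * (1 + t) \<le> L t ^ 4"
    proof -
      have "q L0 \<le> L0 ^ 4" "q L0 * t \<le> t"
        using t \<open>q L0 > 0\<close> by (simp_all add: q_def mult_left_le_one_le)
      moreover have "L0 ^ 4 + t \<le> L t ^ 4"
        unfolding L0_def using \<open>\<omega> \<ge> 1\<close> flow_bounds \<epsilon>1_le turning t
        by (intro L_growth) (auto intro: order_trans)
      ultimately show ?thesis by (simp add: distrib_left)
    qed
    have bound: "\<bar>k m t u\<bar> \<le> C L0 E0 * (1 + t) powr (- (real m + 1 + c1) / 4)" for u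
    proof -
      have "(q L0 * (1 + t)) ^ (m + 1) * \<bar>k m t u\<bar> ^ 4 \<le> (L t ^ 4) ^ (m + 1) * \<bar>k m t u\<bar> ^ 4"
        using growth \<open>q L0 > 0\<close> t by (intro mult_right_mono power_mono) auto
      also have "\<dots> = L t ^ (4 * (m + 1)) * \<bar>k m t u\<bar> ^ 4" by (simp only: power_mult)
      also have "\<dots> \<le> scaled_energy (\<gamma> t) * Q l t"
        unfolding l_def by (rule curvature_deriv_sup_bound[OF t \<open>m \<ge> 1\<close>])
      also have "\<dots> \<le> (c3 * p L0 powr (- c1) * (1 + t) powr (- c1)) * M L0 E0"
        using energy Q_le Q_nonneg \<open>c3 > 0\<close> by (intro mult_mono) auto
      finally have "\<bar>k m t u\<bar> ^ 4 \<le> (c3 * p L0 powr (- c1) * (1 + t) powr (- c1)) * M L0 E0 / (q L0 * (1 + t)) ^ (m + 1)"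
        using \<open>q L0 > 0\<close> t by (simp add: pos_le_divide_eq mult.commute)
      also have "\<dots> = R L0 E0 * ((1 + t) powr (- c1) / (1 + t) ^ (m + 1))"
        unfolding R_def power_mult_distrib times_divide_times_eq by (simp only: mult_ac)
      also have "(1 + t) powr (- c1) / (1 + t) ^ (m + 1) = (1 + t) powr (- (real m + 1 + c1))"
      proof -
        have "(1 + t) ^ (m + 1) = (1 + t) powr (real m + 1)"
          using t powr_realpow[of "1 + t" "m + 1"] by (simp add: add.commute)
        moreover have "- (real m + 1 + c1) = - c1 - (real m + 1)" by simp
        ultimately show ?thesis by (simp only: powr_diff)
      qed
      finally have fourth: "\<bar>k m t u\<bar> ^ 4 \<le> R L0 E0 * (1 + t) powr (- (real m + 1 + c1))" .
      have "\<bar>k m t u\<bar> = (\<bar>k m t u\<bar> ^ 4) powr (1/4)"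
      proof (cases "k m t u = 0")
        case False
        then have "\<bar>k m t u\<bar> ^ 4 = \<bar>k m t u\<bar> powr 4" by (intro powr_numeral[symmetric]) simp
        also have "\<dots> powr (1/4) = \<bar>k m t u\<bar>" unfolding powr_powr using False by simp
        finally show ?thesis by simp
      qed simp
      also have "\<dots> \<le> (R L0 E0 * (1 + t) powr (- (real m + 1 + c1))) powr (1/4)"
        using fourth by (intro powr_mono2) auto
      also have "\<dots> = C L0 E0 * (1 + t) powr (- (real m + 1 + c1) / 4)"
        unfolding C_def powr_mult powr_powr by simp
      finally show ?thesis .
    qed
    have "sup_norm (curvature_deriv (\<gamma> t) m) \<le> C L0 E0 * (1 + t) powr (- (real m + 1 + c1) / 4)"
      unfolding sup_norm_def using bound by (intro cSUP_least) (auto simp: k_def)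
    then show "sup_norm (curvature_deriv (\<gamma> t) m)
              \<le> C (curve_length (\<gamma> 0)) (L2_norm_sq (\<gamma> 0) (curvature_deriv (\<gamma> 0) (2 * m + 1)))
                 * (1 + t) powr (- (real m + 1 + c1) / 4)"
      by (simp add: L0_def L_def E0_def l_def)
  qed
qed

end
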